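(* The pseudomultipliers of the Fock space $\Phi$ are precisely the finite modifications of the proper rational functions. That is, a function $\psi:D_\psi\subset\mathbb{C}\to\mathbb{C}$ is a pseudomultiplier of $\Phi$ if and only if there is a proper rational function $\phi$ such that $\psi$ is a finite modification of $\phi$.
   Context: The Fock space $\Phi$ is the Hilbert space of functions on $\mathbb{C}$ with reproducing kernel $k(\lambda,\mu)=e^{\lambda\bar\mu}$; it consists of all entire functions $f$ with $\int_{\mathbb{C}}|f(z)|^2e^{-|z|^2}\,dA<\infty$ ($dA$ area measure), equivalently $f(z)=\sum_{n\ge0} a_nz^n$ with $\sum_n|a_n|^2n!<\infty$, and has orthonormal basis $(z^n/\sqrt{n!})_{n\ge0}$. A rational function is proper if it has a finite limit at infinity. The domain $D_\phi$ of a rational function $\phi$ is the complement in $\mathbb{C}$ of its set of poles (removable singularities being removed). For functions $\phi,\psi$ with domains $D_\phi,D_\psi\subset\mathbb{C}$, $\psi$ is a finite modification of $\phi$ if $D_\psi\supset D_\phi$, $D_\psi\setminus D_\phi$ is finite, and $\phi,\psi$ agree at all but finitely many points of $D_\phi$. Let $H$ be a Hilbert space of functions on a set $\Omega$ (here $H=\Phi$, $\Omega=\mathbb{C}$). A subset $D\subset\Omega$ is a set of uniqueness for $H$ if $f,g\in H$ and $f|D=g|D$ imply $f=g$. Write $H|D=\{h|D:h\in H\}$. For $\psi:D_\psi\subset\Omega\to\mathbb{C}$ and $h\in H$, $\psi h$ denotes the function on $D_\psi$ given by the pointwise product of $\psi$ and $h|D_\psi$; for $E\subset H$, $\psi E=\{\psi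 h:h\in E\}$. Suppose $D_\psi$ is a set of uniqueness for $H$. A point $\alpha\in\Omega$ is a singularity of $\psi$ if there exists $h\in H$ with $h(\alpha)=0$ such that $\psi h$ has an extension $g\in H$ with $g(\alpha)\neq 0$ (necessarily $\alpha\notin D_\psi$). For an integer $m\ge 0$, $\psi:D_\psi\subset\Omega\to\mathbb{C}$ is an $m$-pseudomultiplier of $H$ if: (1) $D_\psi$ is a set of uniqueness for $H$; (2) $\Omega\setminus D_\psi$ consists of singularities of $\psi$ and contains at most $m$ points; (3) there is a closed subspace $E$ of codimension $m$ in $H$ such that $\psi E\subset H|D_\psi$. A pseudomultiplier of $H$ is an $m$-pseudomultiplier for some integer $m\ge0$. *)

theory Defs
  imports "HOL-Complex_Analysis.Complex_Analysis"
begin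

text \<open>
  A space of functions on a set \<open>\<Omega>\<close> is given by its underlying set \<open>H\<close> of functions and its norm
  \<open>N\<close>; the set \<open>\<Omega>\<close> is the whole type \<open>'a\<close>. A function \<open>\<psi>\<close> with domain \<open>D\<close> is given by the pair of
  \<open>D\<close> and a total function \<open>\<psi>\<close> whose values outside \<open>D\<close> are irrelevant.
\<close>

definition uniqueness_set :: "('a \<Rightarrow> complex) set \<Rightarrow> 'a set \<Rightarrow> bool" where
  "uniqueness_set H D \<longleftrightarrow> (\<forall>f\<in>H. \<forall>g\<in>H. (\<forall>z\<in>D. f z = g z) \<longrightarrow> f = g)"

definition closed_subspace ::
  "('a \<Rightarrow> complex) set \<Rightarrow> (('a \<Rightarrow> complex) \<Rightarrow> real) \<Rightarrow> ('a \<Rightarrow> complex) set \<Rightarrow> bool" where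
  "closed_subspace H N E \<longleftrightarrow>
     E \<subseteq> H \<and>
     (\<lambda>z. 0) \<in> E \<and>
     (\<forall>f\<in>E. \<forall>g\<in>E. (\<lambda>z. f z + g z) \<in> E) \<and>
     (\<forall>c. \<forall>f\<in>E. (\<lambda>z. c * f z) \<in> E) \<and>
     (\<forall>f g. (\<forall>n. f n \<in> E) \<longrightarrow> g \<in> H \<longrightarrow> (\<lambda>n::nat. N (\<lambda>z. f n z - g z)) \<longlonglongrightarrow> 0 \<longrightarrow> g \<in> E)"

text \<open>The cosets of \<open>b 0, \<dots>, b (m - 1)\<close> form a basis of the quotient \<open>H / E\<close>.\<close>

definition has_codimension ::
  "('a \<Rightarrow> complex) set \<Rightarrow> ('a \<Rightarrow> complex) set \<Rightarrow> nat \<Rightarrow> bool" where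
  "has_codimension H E m \<longleftrightarrow>
     (\<exists>b :: nat \<Rightarrow> 'a \<Rightarrow> complex.
        (\<forall>i<m. b i \<in> H) \<and>
        (\<forall>h\<in>H. \<exists>c :: nat \<Rightarrow> complex. (\<lambda>z. h z - (\<Sum>i<m. c i * b i z)) \<in> E) \<and>
        (\<forall>c :: nat \<Rightarrow> complex. (\<lambda>z. \<Sum>i<m. c i * b i z) \<in> E \<longrightarrow> (\<forall>i<m. c i = 0)))"

definition singularity ::
  "('a \<Rightarrow> complex) set \<Rightarrow> 'a set \<Rightarrow> ('a \<Rightarrow> complex) \<Rightarrow> 'a \<Rightarrow> bool" where
  "singularity H D \<psi> \<alpha> \<longleftrightarrow>
     (\<exists>h\<in>H. h \<alpha> = 0 \<and> (\<exists>g\<in>H. (\<forall>z\<in>D. g z = \<psi> z * h z) \<and> g \<alpha> \<noteq> 0))"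

definition m_pseudomultiplier ::
  "nat \<Rightarrow> ('a \<Rightarrow> complex) set \<Rightarrow> (('a \<Rightarrow> complex) \<Rightarrow> real) \<Rightarrow> 'a set \<Rightarrow> ('a \<Rightarrow> complex) \<Rightarrow> bool" where
  "m_pseudomultiplier m H N D \<psi> \<longleftrightarrow>
     uniqueness_set H D \<and>
     (\<forall>\<alpha>\<in>- D. singularity H D \<psi> \<alpha>) \<and> finite (- D) \<and> card (- D) \<le> m \<and>
     (\<exists>E. closed_subspace H N E \<and> has_codimension H E m \<and>
        (\<forall>h\<in>E. \<exists>g\<in>H. \<forall>z\<in>D. g z = \<psi> z * h z))"

definition pseudomultiplier ::
  "('a \<Rightarrow> complex) set \<Rightarrow> (('a \<Rightarrow> complex) \<Rightarrow> real) \<Rightarrow> 'a set \<Rightarrow> ('a \<Rightarrow> complex) \<Rightarrow> bool" where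
  "pseudomultiplier H N D \<psi> \<longleftrightarrow> (\<exists>m. m_pseudomultiplier m H N D \<psi>)"

definition fock_space :: "(complex \<Rightarrow> complex) set" where
  "fock_space = {f. f holomorphic_on UNIV \<and>
     integrable lborel (\<lambda>z. (cmod (f z))\<^sup>2 * exp (- (cmod z)\<^sup>2))}"

text \<open>
  With the factor \<open>1 / pi\<close> the monomials \<open>z ^ n / sqrt (fact n)\<close> are orthonormal and the reproducing
  kernel is \<open>exp (\<lambda> * cnj \<mu>)\<close>.
\<close>

definition fock_norm :: "(complex \<Rightarrow> complex) \<Rightarrow> real" where
  "fock_norm f =
     sqrt (1 / pi * (LINT z|lborel. (cmod (f z))\<^sup>2 * exp (- (cmod z)\<^sup>2)))"

text \<open>
  The quotient \<open>p / q\<close> need not be in lowest terms: points where it has a removable singularity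
  belong to the domain, and \<^const>\<open>remove_sings\<close> supplies the value there.
\<close>

definition rational_function :: "complex set \<Rightarrow> (complex \<Rightarrow> complex) \<Rightarrow> bool" where
  "rational_function D \<phi> \<longleftrightarrow>
     (\<exists>p q :: complex poly. q \<noteq> 0 \<and>
        D = - {z. is_pole (\<lambda>w. poly p w / poly q w) z} \<and>
        (\<forall>z\<in>D. \<phi> z = remove_sings (\<lambda>w. poly p w / poly q w) z))"

text \<open>
  The limit does not depend on the values of \<open>\<phi>\<close> at the poles, since there are only finitely many.
\<close>

definition proper_rational_function :: "complex set \<Rightarrow> (complex \<Rightarrow> complex) \<Rightarrow> bool" where
  "proper_rational_function D \<phi> \<longleftrightarrow>
     rational_function D \<phi> \<and> (\<exists>l. (\<phi> \<longlongrightarrow> l) at_infinity)"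

definition finite_modification ::
  "'a set \<Rightarrow> ('a \<Rightarrow> 'b) \<Rightarrow> 'a set \<Rightarrow> ('a \<Rightarrow> 'b) \<Rightarrow> bool" where
  "finite_modification D\<^sub>\<psi> \<psi> D\<^sub>\<phi> \<phi> \<longleftrightarrow>
     D\<^sub>\<phi> \<subseteq> D\<^sub>\<psi> \<and> finite (D\<^sub>\<psi> - D\<^sub>\<phi>) \<and> finite {z \<in> D\<^sub>\<phi>. \<phi> z \<noteq> \<psi> z}"

end

theory Submission
  imports Defs "HOL-Probability.Distributions"
begin

text \<open>
  A pseudomultiplier \<open>\<psi>\<close> acts on a subspace \<open>E\<close> of finite codimension. Such a subspace contains a
  nonzero polynomial \<open>p\<close>, and \<open>\<psi> p\<close> extends to an entire function \<open>g\<close>, so \<open>\<psi>\<close> coincides with the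
  meromorphic function \<open>g / p\<close> up to finitely many points. Everything depends on showing that \<open>\<psi>\<close> is
  bounded near infinity; then Liouville's theorem makes \<open>g\<close> a polynomial and \<open>g / p\<close> a proper rational
  function.

  A multiplier of the whole Fock space is bounded because its adjoint has the reproducing kernels as
  eigenvectors. The argument in \<open>multiplier_bounded_near_infinity\<close> keeps this idea for a subspace of
  finite codimension, in an elementary form. Normalized kernels at sparse points are
  almost independent bumps (\<open>norm_normalized_kernel\<close>), so a suitable absolutely convergent series of them
  would be mapped by an unbounded \<open>\<psi>\<close> to a function that violates the pointwise growth bound
  \<open>fock_pointwise_bound\<close>; using \<open>m + 1\<close> series over disjoint sets of kernels, some combination of them
  lies in \<open>E\<close>, by \<open>finite_codimension_combination\<close>, and has the same defect.

  Conversely, let \<open>\<phi> = p / q\<close> be proper and in lowest terms, and let \<open>\<psi>\<close> be a finite modification of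
  \<open>\<phi>\<close>. Multiplying \<open>q\<close> by linear factors that vanish at the modified points gives a polynomial whose
  multiples in the Fock space are mapped into the Fock space by \<open>\<psi>\<close>, whatever the modified values are.
  By \<open>has_codimension_multiples\<close> and \<open>closed_subspace_multiples\<close> these multiples form a closed
  subspace whose codimension is the degree of the polynomial. The first fact is division with remainder for entire
  functions. The second one holds because norm convergence implies uniform convergence on discs, which the maximum
  principle preserves under division by linear factors.
\<close>

section \<open>Rotation invariance of Lebesgue measure on the complex plane\<close>

lemma nn_integral_lborel_translate:
  fixes f :: "'a::euclidean_space \<Rightarrow> ennreal"
  assumes [measurable]: "f \<in> borel_measurable borel"
  shows "(\<integral>\<^sup>+x. f (c + x) \<partial>lborel) = (\<integral>\<^sup>+x. f x \<partial>lborel)"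
proof -
  have "(\<integral>\<^sup>+x. f x \<partial>lborel) = (\<integral>\<^sup>+x. f x \<partial>distr lborel borel ((+) c))"
    by (simp add: lborel_distr_plus)
  also have "\<dots> = (\<integral>\<^sup>+x. f (c + x) \<partial>lborel)"
    by (rule nn_integral_distr) auto
  finally show ?thesis ..
qed

text \<open>
  This is uniqueness of Haar measure in miniature. The indicator \<open>f\<close> of the unit disc is itself rotation
  invariant and has finite nonzero mass \<open>v\<close>. Two translations and two applications of Fubini's theorem
  turn \<open>v\<close> times the integral of \<open>g\<close> into \<open>v\<close> times the integral of the rotated function.
\<close>

lemma nn_integral_lborel_rotate:
  fixes g :: "complex \<Rightarrow> ennreal"
  assumes [measurable]: "g \<in> borel_measurable borel" and u: "cmod u = 1"
  shows "(\<integral>\<^sup>+z. g (u * z) \<partial>lborel) = (\<integral>\<^sup>+z. g z \<partial>lborel)"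
proof -
  define f :: "complex \<Rightarrow> ennreal" where "f = indicator (ball 0 1)"
  define v where "v = (\<integral>\<^sup>+z. f z \<partial>lborel)"
  have [measurable]: "f \<in> borel_measurable borel"
    unfolding f_def by (intro borel_measurable_indicator borel_open) simp
  have f_sym: "f z = f w" if "cmod z = cmod w" for z w
    using that by (auto simp: f_def indicator_def)
  have "v = emeasure lborel (ball (0::complex) 1)"
    unfolding v_def f_def by (subst nn_integral_indicator) auto
  moreover have "emeasure lborel (ball (0::complex) 1) \<noteq> 0"
    using content_ball_pos[of 1 "0::complex"] measure_eq_emeasure_eq_ennreal[of 0 lborel] by fastforce
  ultimately have v: "v \<noteq> 0" "v \<noteq> \<infinity>"
    using emeasure_lborel_ball_finite[of "0::complex" 1] by auto
  have "v * (\<integral>\<^sup>+z. g z \<partial>lborel) = (\<integral>\<^sup>+y. \<integral>\<^sup>+x. f (u * y) * g x \<partial>lborel \<partial>lborel)"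
  proof -
    have "v = (\<integral>\<^sup>+y. f (u * y) \<partial>lborel)"
      unfolding v_def by (intro nn_integral_cong f_sym) (simp add: norm_mult u)
    then show ?thesis by (simp add: nn_integral_cmult nn_integral_multc)
  qed
  also have "\<dots> = (\<integral>\<^sup>+y. \<integral>\<^sup>+x. f (u * y) * g (u * y + x) \<partial>lborel \<partial>lborel)"
    by (intro nn_integral_cong nn_integral_lborel_translate[symmetric]) auto
  also have "\<dots> = (\<integral>\<^sup>+x. \<integral>\<^sup>+y. f (u * y) * g (u * y + x) \<partial>lborel \<partial>lborel)"
    by (rule lborel_pair.Fubini') measurable
  also have "\<dots> = (\<integral>\<^sup>+x. \<integral>\<^sup>+y. f (u * y - x) * g (u * y) \<partial>lborel \<partial>lborel)"
  proof (rule nn_integral_cong)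
    fix x :: complex
    have "u \<noteq> 0" using u by auto
    then have "f (u * y) * g (u * y + x) = f (u * (x / u + y) - x) * g (u * (x / u + y))" for y
      by (simp add: distrib_left add.commute)
    then show "(\<integral>\<^sup>+y. f (u * y) * g (u * y + x) \<partial>lborel) = (\<integral>\<^sup>+y. f (u * y - x) * g (u * y) \<partial>lborel)"
      using nn_integral_lborel_translate[of "\<lambda>y. f (u * y - x) * g (u * y)" "x / u"] by simp
  qed
  also have "\<dots> = (\<integral>\<^sup>+y. \<integral>\<^sup>+x. f (u * y - x) * g (u * y) \<partial>lborel \<partial>lborel)"
    by (rule lborel_pair.Fubini') measurable
  also have "\<dots> = (\<integral>\<^sup>+y. v * g (u * y) \<partial>lborel)"
  proof (rule nn_integral_cong)
    fix y :: complex
    have "(\<integral>\<^sup>+x. f (u * y - x) \<partial>lborel) = (\<integral>\<^sup>+x. f (- (u * y) + x) \<partial>lborel)"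
      by (intro nn_integral_cong f_sym) (simp add: norm_minus_commute)
    also have "\<dots> = v"
      unfolding v_def by (rule nn_integral_lborel_translate) auto
    finally show "(\<integral>\<^sup>+x. f (u * y - x) * g (u * y) \<partial>lborel) = v * g (u * y)"
      by (simp add: nn_integral_multc)
  qed
  also have "\<dots> = v * (\<integral>\<^sup>+y. g (u * y) \<partial>lborel)"
    by (simp add: nn_integral_cmult)
  finally show ?thesis
    using v by (auto simp: ennreal_mult_cancel_left)
qed

section \<open>Point evaluations on the Fock space\<close>

lemma circle_mean_value:
  assumes F: "F holomorphic_on UNIV"
  shows "((\<lambda>t::real. F (cis (2 * pi * t) * w)) has_integral F 0) {0..1}"
proof -
  have "(\<lambda>\<zeta>. F (\<zeta> * w)) holomorphic_on UNIV"
    by (rule holomorphic_on_compose_gen[OF _ F, unfolded o_def]) (auto intro!: holomorphic_intros)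
  then have "((\<lambda>\<zeta>. F (\<zeta> * w) / (\<zeta> - 0)) has_contour_integral (2 * of_real pi * \<i> * F (0 * w))) (circlepath 0 1)"
    by (intro Cauchy_integral_circlepath_simple) (auto intro: holomorphic_on_subset)
  then have "((\<lambda>x. F (circlepath 0 1 x * w) / circlepath 0 1 x *
       (2 * complex_of_real pi * \<i> * exp (2 * complex_of_real pi * \<i> * x)))
      has_integral 2 * complex_of_real pi * \<i> * F 0) {0..1}"
    unfolding has_contour_integral_def
    by (subst (asm) has_integral_cong)
       (auto simp: vector_derivative_circlepath01)
  then have "((\<lambda>x. (2 * complex_of_real pi * \<i>) * F (cis (2 * pi * x) * w))
      has_integral (2 * complex_of_real pi * \<i>) * F 0) {0..1}"
    by (rule has_integral_eq[rotated]) (auto simp: circlepath cis_conv_exp mult_ac)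
  from has_integral_mult_right[OF this, of "1 / (2 * complex_of_real pi * \<i>)"]
  show ?thesis by simp
qed

lemma norm_square_le_circle_mean:
  assumes F: "F holomorphic_on UNIV"
  shows "ennreal ((cmod (F 0))\<^sup>2)
    \<le> (\<integral>\<^sup>+t. indicator {0..1} t * ennreal ((cmod (F (cis (2 * pi * t) * w)))\<^sup>2) \<partial>lborel)"
proof -
  have 1: "((\<lambda>t::real. (F (cis (2 * pi * t) * w))\<^sup>2) has_integral (F 0)\<^sup>2) {0..1}"
    using circle_mean_value[of "\<lambda>z. (F z)\<^sup>2" w] F by (auto intro!: holomorphic_intros)
  have contF: "continuous_on UNIV F"
    using F holomorphic_on_imp_continuous_on by blast
  have cont: "continuous_on UNIV (\<lambda>t::real. (cmod (F (cis (2 * pi * t) * w)))\<^sup>2)"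
    by (intro continuous_intros continuous_on_compose2[OF contF]) auto
  then have int: "(\<lambda>t::real. (cmod (F (cis (2 * pi * t) * w)))\<^sup>2) integrable_on {0..1}"
    by (intro integrable_continuous_real) (auto intro: continuous_on_subset)
  let ?I = "integral {0..1} (\<lambda>t::real. (cmod (F (cis (2 * pi * t) * w)))\<^sup>2)"
  have "cmod (integral {0..1} (\<lambda>t::real. (F (cis (2 * pi * t) * w))\<^sup>2)) \<le> ?I"
    using 1 int by (intro integral_norm_bound_integral) (auto simp: norm_power)
  then have "(cmod (F 0))\<^sup>2 \<le> ?I"
    using 1 by (simp add: integral_unique norm_power)
  moreover have "(\<integral>\<^sup>+t. indicator {0..1} t * ennreal ((cmod (F (cis (2 * pi * t) * w)))\<^sup>2) \<partial>lborel) = ennreal ?I"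
  proof -
    have meas: "(\<lambda>t::real. (cmod (F (cis (2 * pi * t) * w)))\<^sup>2) \<in> borel_measurable borel"
      using cont by (rule borel_measurable_continuous_onI)
    have "((\<lambda>t. indicator {0..1} t * (cmod (F (cis (2 * pi * t) * w)))\<^sup>2) has_integral ?I) UNIV"
      using integrable_integral[OF int] unfolding has_integral_restrict_UNIV[of "{0..1}", symmetric]
      by (rule has_integral_eq[rotated]) (auto simp: indicator_def)
    then have "(\<integral>\<^sup>+t. ennreal (indicator {0..1} t * (cmod (F (cis (2 * pi * t) * w)))\<^sup>2) \<partial>lborel) = ennreal ?I"
      using meas by (intro nn_integral_has_integral_lborel) auto
    then show ?thesis
      by (simp add: ennreal_mult' ennreal_indicator[symmetric])
  qed
  ultimately show ?thesis by (simp add: ennreal_leI)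
qed

text \<open>
  Write \<open>(F 0)\<^sup>2\<close> as a mean of \<open>F\<^sup>2\<close> over the circle through \<open>w\<close>, integrate over \<open>w\<close> against the Gaussian
  and exchange the integrals: by rotation invariance every angle contributes the same amount.
\<close>

lemma gaussian_mean_value_bound:
  assumes F: "F holomorphic_on UNIV"
  shows "(\<integral>\<^sup>+w. ennreal (exp (- (cmod w)\<^sup>2)) \<partial>lborel) * ennreal ((cmod (F 0))\<^sup>2)
    \<le> (\<integral>\<^sup>+w. ennreal ((cmod (F w))\<^sup>2 * exp (- (cmod w)\<^sup>2)) \<partial>lborel)"
proof -
  define I where "I = (\<integral>\<^sup>+w. ennreal ((cmod (F w))\<^sup>2 * exp (- (cmod w)\<^sup>2)) \<partial>lborel)"
  have [measurable]: "F \<in> borel_measurable borel"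
    using F by (intro borel_measurable_continuous_onI holomorphic_on_imp_continuous_on)
  have [measurable]: "(cis :: real \<Rightarrow> complex) \<in> borel_measurable borel"
    by (intro borel_measurable_continuous_onI continuous_intros)
  have "(\<integral>\<^sup>+w. ennreal (exp (- (cmod w)\<^sup>2)) \<partial>lborel) * ennreal ((cmod (F 0))\<^sup>2)
      = (\<integral>\<^sup>+w. ennreal (exp (- (cmod w)\<^sup>2)) * ennreal ((cmod (F 0))\<^sup>2) \<partial>lborel)"
    by (simp add: nn_integral_multc)
  also have "\<dots> \<le> (\<integral>\<^sup>+w. ennreal (exp (- (cmod w)\<^sup>2)) *
      (\<integral>\<^sup>+t. indicator {0..1::real} t * ennreal ((cmod (F (cis (2 * pi * t) * w)))\<^sup>2) \<partial>lborel) \<partial>lborel)"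
    by (intro nn_integral_mono mult_left_mono norm_square_le_circle_mean F) auto
  also have "\<dots> = (\<integral>\<^sup>+w. \<integral>\<^sup>+t. ennreal (exp (- (cmod w)\<^sup>2)) *
      (indicator {0..1::real} t * ennreal ((cmod (F (cis (2 * pi * t) * w)))\<^sup>2)) \<partial>lborel \<partial>lborel)"
    by (intro nn_integral_cong nn_integral_cmult[symmetric]) measurable
  also have "\<dots> = (\<integral>\<^sup>+t. \<integral>\<^sup>+w. ennreal (exp (- (cmod w)\<^sup>2)) *
      (indicator {0..1::real} t * ennreal ((cmod (F (cis (2 * pi * t) * w)))\<^sup>2)) \<partial>lborel \<partial>lborel)"
    by (rule lborel_pair.Fubini') measurable
  also have "\<dots> = (\<integral>\<^sup>+t. indicator {0..1::real} t * I \<partial>lborel)"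
  proof (rule nn_integral_cong)
    fix t :: real
    let ?u = "cis (2 * pi * t)"
    have "(\<integral>\<^sup>+w. ennreal (exp (- (cmod w)\<^sup>2)) * (indicator {0..1::real} t * ennreal ((cmod (F (?u * w)))\<^sup>2)) \<partial>lborel)
      = (\<integral>\<^sup>+w. indicator {0..1} t * ennreal ((cmod (F (?u * w)))\<^sup>2 * exp (- (cmod (?u * w))\<^sup>2)) \<partial>lborel)"
      by (intro nn_integral_cong) (simp add: norm_mult ennreal_mult mult_ac)
    also have "\<dots> = indicator {0..1} t * (\<integral>\<^sup>+w. ennreal ((cmod (F (?u * w)))\<^sup>2 * exp (- (cmod (?u * w))\<^sup>2)) \<partial>lborel)"
      by (rule nn_integral_cmult) measurable
    also have "(\<integral>\<^sup>+w. ennreal ((cmod (F (?u * w)))\<^sup>2 * exp (- (cmod (?u * w))\<^sup>2)) \<partial>lborel) = I"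
      unfolding I_def
      by (rule nn_integral_lborel_rotate[where g = "\<lambda>w. ennreal ((cmod (F w))\<^sup>2 * exp (- (cmod w)\<^sup>2))"]) auto
    finally show "(\<integral>\<^sup>+w. ennreal (exp (- (cmod w)\<^sup>2)) * (indicator {0..1::real} t *
      ennreal ((cmod (F (?u * w)))\<^sup>2)) \<partial>lborel) = indicator {0..1} t * I" .
  qed
  also have "\<dots> = I"
    by (simp add: nn_integral_multc)
  finally show ?thesis unfolding I_def .
qed

text \<open>
  The factor by which translating the Gaussian weight by \<open>a\<close> changes it is the squared modulus of a
  nonvanishing entire function, so a bound at the origin can be moved to any other point.
\<close>

lemma exp_translate_weight:
  "exp (- (cmod (a + w))\<^sup>2) * exp ((cmod a)\<^sup>2)
     = (cmod (exp (- (cnj a * w))))\<^sup>2 * exp (- (cmod w)\<^sup>2)"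
proof -
  have "(cmod (a + w))\<^sup>2 = (cmod a)\<^sup>2 + (cmod w)\<^sup>2 + 2 * Re (cnj a * w)"
    by (simp add: cmod_power2) (simp add: power2_eq_square algebra_simps)
  then show ?thesis
    by (simp add: norm_exp_eq_Re power2_eq_square flip: exp_add)
qed

text \<open>
  Point evaluation at \<open>z\<close> is bounded, with norm at most a constant times
  \<open>exp ((cmod z)\<^sup>2 / 2)\<close>, which is the norm of the reproducing kernel at \<open>z\<close>: apply the bound at the
  origin to \<open>f\<close> translated by \<open>z\<close> and divided by the entire function that compensates the weight.
\<close>

lemma fock_pointwise_bound:
  obtains C where "C > 0"
    and "\<And>f z. f \<in> fock_space \<Longrightarrow> cmod (f z) \<le> C * exp ((cmod z)\<^sup>2 / 2) * fock_norm f"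
proof -
  \<comment> \<open>A lower bound for the mass of the Gaussian, whose density is at least exp (-1) on the unit disc.\<close>
  define K where "K = exp (-1) * measure lborel (ball (0::complex) 1)"
  have K0: "K > 0"
    unfolding K_def by (simp add: content_ball_pos)
  have K: "ennreal K \<le> (\<integral>\<^sup>+(w::complex). ennreal (exp (- (cmod w)\<^sup>2)) \<partial>lborel)"
  proof -
    have "ennreal K = ennreal (exp (-1)) * emeasure lborel (ball (0::complex) 1)"
      using emeasure_lborel_ball_finite[of "0::complex" 1]
      unfolding K_def by (subst emeasure_eq_ennreal_measure) (auto intro: ennreal_mult')
    also have "\<dots> = (\<integral>\<^sup>+w. ennreal (exp (-1)) * indicator (ball (0::complex) 1) w \<partial>lborel)"
      by (subst nn_integral_cmult_indicator) auto
    also have "\<dots> \<le> (\<integral>\<^sup>+(w::complex). ennreal (exp (- (cmod w)\<^sup>2)) \<partial>lborel)"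
      by (intro nn_integral_mono) (auto simp: indicator_def power_le_one intro!: ennreal_leI)
    finally show ?thesis .
  qed
  show thesis
  proof (rule that[of "sqrt (pi / K)"])
    fix f z assume f: "f \<in> fock_space"
    then have hol: "f holomorphic_on UNIV"
      and int: "integrable lborel (\<lambda>z. (cmod (f z))\<^sup>2 * exp (- (cmod z)\<^sup>2))"
      by (auto simp: fock_space_def)
    define J where "J = (LINT z|lborel. (cmod (f z))\<^sup>2 * exp (- (cmod z)\<^sup>2))"
    have J0: "J \<ge> 0" unfolding J_def by (rule Bochner_Integration.integral_nonneg) auto
    have J: "fock_norm f = sqrt (J / pi)" by (simp add: fock_norm_def J_def)
    have [measurable]: "f \<in> borel_measurable borel"
      using hol by (intro borel_measurable_continuous_onI holomorphic_on_imp_continuous_on)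
    define F where "F w = f (z + w) * exp (- (cnj z * w))" for w
    have "(\<lambda>w. f (z + w)) holomorphic_on UNIV"
      by (rule holomorphic_on_compose_gen[OF _ hol, unfolded o_def]) (auto intro!: holomorphic_intros)
    then have F: "F holomorphic_on UNIV"
      unfolding F_def by (intro holomorphic_intros)
    have eq: "(cmod (F w))\<^sup>2 * exp (- (cmod w)\<^sup>2)
      = exp ((cmod z)\<^sup>2) * ((cmod (f (z + w)))\<^sup>2 * exp (- (cmod (z + w))\<^sup>2))" for w
      using exp_translate_weight[of z w] by (simp add: F_def norm_mult power_mult_distrib mult_ac)
    have "ennreal K * ennreal ((cmod (F 0))\<^sup>2) \<le>
       (\<integral>\<^sup>+w. ennreal (exp ((cmod z)\<^sup>2) * ((cmod (f (z + w)))\<^sup>2 * exp (- (cmod (z + w))\<^sup>2))) \<partial>lborel)"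
      using order_trans[OF mult_right_mono[OF K] gaussian_mean_value_bound[OF F]] by (simp add: eq)
    also have "\<dots> = ennreal (exp ((cmod z)\<^sup>2)) *
        (\<integral>\<^sup>+w. ennreal ((cmod (f (z + w)))\<^sup>2 * exp (- (cmod (z + w))\<^sup>2)) \<partial>lborel)"
      by (subst nn_integral_cmult[symmetric]) (auto simp: ennreal_mult')
    also have "(\<integral>\<^sup>+w. ennreal ((cmod (f (z + w)))\<^sup>2 * exp (- (cmod (z + w))\<^sup>2)) \<partial>lborel)
        = (\<integral>\<^sup>+w. ennreal ((cmod (f w))\<^sup>2 * exp (- (cmod w)\<^sup>2)) \<partial>lborel)"
      by (rule nn_integral_lborel_translate[where f = "\<lambda>w. ennreal ((cmod (f w))\<^sup>2 * exp (- (cmod w)\<^sup>2))"]) auto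
    also have "\<dots> = ennreal J"
      unfolding J_def by (rule nn_integral_eq_integral[OF int]) auto
    finally have "K * (cmod (f z))\<^sup>2 \<le> exp ((cmod z)\<^sup>2) * J"
      using K0 J0 by (simp add: F_def flip: ennreal_mult')
    then have "(cmod (f z))\<^sup>2 \<le> exp ((cmod z)\<^sup>2) * J / K"
      using K0 by (simp add: field_simps)
    also have "\<dots> = (sqrt (pi / K) * exp ((cmod z)\<^sup>2 / 2) * fock_norm f)\<^sup>2"
      using K0 J0 by (simp add: J power_mult_distrib exp_double[symmetric])
    finally show "cmod (f z) \<le> sqrt (pi / K) * exp ((cmod z)\<^sup>2 / 2) * fock_norm f"
      by (rule power2_le_imp_le) (use K0 J0 in \<open>simp add: J\<close>)
  qed (use K0 in simp)
qed

section \<open>Membership in the Fock space\<close>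

lemma gaussian_integrable:
  "integrable lborel (\<lambda>z::complex. exp (- (cmod z)\<^sup>2 / 2))"
proof (rule integrableI_nonneg)
  have eq: "exp (- x\<^sup>2 / 2) = sqrt (2 * pi) * normal_density 0 1 x" for x :: real
    by (simp add: normal_density_def)
  have "integrable lborel (\<lambda>x::real. exp (- x\<^sup>2 / 2))"
    unfolding eq by (intro integrable_mult_right integrable_normal_density) auto
  then have fin: "(\<integral>\<^sup>+x. ennreal (exp (- x\<^sup>2 / 2)) \<partial>(lborel :: real measure)) < \<infinity>"
    by (subst nn_integral_eq_integral) auto
  have "(\<integral>\<^sup>+z. ennreal (exp (- (cmod z)\<^sup>2 / 2)) \<partial>lborel)
     = (\<integral>\<^sup>+(z::complex). (\<Prod>b\<in>Basis. ennreal (exp (- (z \<bullet> b)\<^sup>2 / 2))) \<partial>lborel)"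
    by (intro nn_integral_cong)
       (auto simp: Basis_complex_def inner_complex_def cmod_power2 add_divide_distrib
             simp flip: ennreal_mult' exp_add)
  also have "\<dots> = (\<Prod>b\<in>(Basis :: complex set). \<integral>\<^sup>+x. ennreal (exp (- x\<^sup>2 / 2)) \<partial>lborel)"
    by (rule nn_integral_lborel_prod) auto
  also have "\<dots> < \<infinity>"
    using fin by (simp add: power_less_top_ennreal)
  finally show "(\<integral>\<^sup>+z. ennreal (exp (- (cmod z)\<^sup>2 / 2)) \<partial>lborel) < \<infinity>" .
qed auto

lemma fock_spaceI:
  assumes f: "f holomorphic_on UNIV" and g: "integrable lborel g"
    and le: "\<And>z. (cmod (f z))\<^sup>2 * exp (- (cmod z)\<^sup>2) \<le> g z"
  shows "f \<in> fock_space"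
proof -
  have [measurable]: "f \<in> borel_measurable borel"
    using f by (intro borel_measurable_continuous_onI holomorphic_on_imp_continuous_on)
  have "integrable lborel (\<lambda>z. (cmod (f z))\<^sup>2 * exp (- (cmod z)\<^sup>2))"
  proof (rule Bochner_Integration.integrable_bound[OF g])
    show "AE z in lborel. norm ((cmod (f z))\<^sup>2 * exp (- (cmod z)\<^sup>2)) \<le> norm (g z)"
      using le by (intro AE_I2) (metis abs_ge_self order_trans norm_ge_zero real_norm_def abs_of_nonneg
         mult_nonneg_nonneg zero_le_power2 exp_ge_zero)
  qed measurable
  with f show ?thesis by (simp add: fock_space_def)
qed

lemma fock_spaceD:
  assumes "f \<in> fock_space"
  shows "f holomorphic_on UNIV" "integrable lborel (\<lambda>z. (cmod (f z))\<^sup>2 * exp (- (cmod z)\<^sup>2))"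
  using assms by (auto simp: fock_space_def)

lemma fock_cmult: "f \<in> fock_space \<Longrightarrow> (\<lambda>z. c * f z) \<in> fock_space"
  by (rule fock_spaceI[where g = "\<lambda>z. (cmod c)\<^sup>2 * ((cmod (f z))\<^sup>2 * exp (- (cmod z)\<^sup>2))"])
     (auto intro!: holomorphic_intros dest: fock_spaceD simp: norm_mult power_mult_distrib)

lemma fock_add:
  assumes f: "f \<in> fock_space" and g: "g \<in> fock_space"
  shows "(\<lambda>z. f z + g z) \<in> fock_space"
proof (rule fock_spaceI)
  show "(\<lambda>z. f z + g z) holomorphic_on UNIV"
    by (intro holomorphic_intros fock_spaceD f g)
  show "integrable lborel (\<lambda>z. 2 * ((cmod (f z))\<^sup>2 * exp (- (cmod z)\<^sup>2)) + 2 * ((cmod (g z))\<^sup>2 * exp (- (cmod z)\<^sup>2)))"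
    by (intro Bochner_Integration.integrable_add integrable_mult_right fock_spaceD f g)
  fix z
  have "(cmod (f z + g z))\<^sup>2 \<le> (cmod (f z) + cmod (g z))\<^sup>2"
    by (intro power_mono norm_triangle_ineq) auto
  also have "\<dots> \<le> 2 * (cmod (f z))\<^sup>2 + 2 * (cmod (g z))\<^sup>2"
    using zero_le_power2[of "cmod (f z) - cmod (g z)"] by (simp add: power2_eq_square algebra_simps)
  finally have "(cmod (f z + g z))\<^sup>2 * exp (- (cmod z)\<^sup>2)
      \<le> (2 * (cmod (f z))\<^sup>2 + 2 * (cmod (g z))\<^sup>2) * exp (- (cmod z)\<^sup>2)"
    by (rule mult_right_mono) simp
  then show "(cmod (f z + g z))\<^sup>2 * exp (- (cmod z)\<^sup>2)
      \<le> 2 * ((cmod (f z))\<^sup>2 * exp (- (cmod z)\<^sup>2)) + 2 * ((cmod (g z))\<^sup>2 * exp (- (cmod z)\<^sup>2))"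
    by (simp add: algebra_simps)
qed

lemma fock_zero: "(\<lambda>z. 0) \<in> fock_space"
  by (simp add: fock_space_def)

lemma fock_diff: "f \<in> fock_space \<Longrightarrow> g \<in> fock_space \<Longrightarrow> (\<lambda>z. f z - g z) \<in> fock_space"
  using fock_add[of f "\<lambda>z. -1 * g z"] fock_cmult[of g "-1"] by simp

lemma fock_sum:
  "finite A \<Longrightarrow> (\<And>i. i \<in> A \<Longrightarrow> f i \<in> fock_space) \<Longrightarrow> (\<lambda>z. \<Sum>i\<in>A. f i z) \<in> fock_space"
  by (induction A rule: finite_induct) (auto intro: fock_zero fock_add)

text \<open>
  One half of the exponent in the weight absorbs the growth of a monomial, since \<open>x ^ n / fact n \<le> exp x\<close>;
  the other half keeps the bound integrable.
\<close>

lemma fock_poly: "poly p \<in> fock_space"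
proof -
  have "(\<lambda>z::complex. z ^ n) \<in> fock_space" for n
  proof (rule fock_spaceI[where g = "\<lambda>z. (2 ^ n * fact n) * exp (- (cmod z)\<^sup>2 / 2)"])
    fix z :: complex
    define x where "x = (cmod z)\<^sup>2 / 2"
    have "x ^ n / fact n \<le> exp x"
    proof -
      have "(\<Sum>k\<in>{n}. x ^ k /\<^sub>R fact k) \<le> (\<Sum>k. x ^ k /\<^sub>R fact k)"
        by (rule sum_le_suminf[OF summable_exp_generic]) (auto simp: x_def)
      also have "\<dots> = exp x" unfolding exp_def ..
      finally show ?thesis by (simp add: divide_inverse mult.commute)
    qed
    then have "(2 * x) ^ n \<le> 2 ^ n * fact n * exp x"
      by (simp add: power_mult_distrib field_simps)
    then have "(2 * x) ^ n * exp (- (2 * x)) \<le> 2 ^ n * fact n * exp x * exp (- (2 * x))"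
      by (rule mult_right_mono) simp
    also have "\<dots> = 2 ^ n * fact n * exp (- x)"
      by (simp add: mult_exp_exp)
    finally show "(cmod (z ^ n))\<^sup>2 * exp (- (cmod z)\<^sup>2) \<le> 2 ^ n * fact n * exp (- (cmod z)\<^sup>2 / 2)"
      by (simp add: x_def norm_power mult.commute flip: power_mult)
  qed (intro holomorphic_intros integrable_mult_right gaussian_integrable)+
  then have "(\<lambda>z. \<Sum>i\<le>degree p. coeff p i * z ^ i) \<in> fock_space"
    by (intro fock_sum fock_cmult) auto
  then show ?thesis by (simp add: poly_altdef[abs_def])
qed

lemma fock_dominated:
  assumes h: "h \<in> fock_space" and G: "G holomorphic_on UNIV"
    and le: "\<And>z. R \<le> cmod z \<Longrightarrow> cmod (G z) \<le> B * cmod (h z)"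
  shows "G \<in> fock_space"
proof -
  have "bounded (G ` cball 0 R)"
    using G by (intro compact_imp_bounded compact_continuous_image)
      (auto intro: holomorphic_on_imp_continuous_on holomorphic_on_subset)
  then obtain M where "\<forall>z\<in>cball 0 R. cmod (G z) \<le> M"
    by (auto simp: bounded_iff)
  then have M: "cmod (G z) \<le> M" if "cmod z \<le> R" for z
    using that by simp
  show ?thesis
  proof (rule fock_spaceI[OF G])
    show "integrable lborel (\<lambda>z. B\<^sup>2 * ((cmod (h z))\<^sup>2 * exp (- (cmod z)\<^sup>2)) + M\<^sup>2 * exp (- (cmod z)\<^sup>2 / 2))"
      by (intro Bochner_Integration.integrable_add integrable_mult_right fock_spaceD h gaussian_integrable)
    fix z
    show "(cmod (G z))\<^sup>2 * exp (- (cmod z)\<^sup>2)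
      \<le> B\<^sup>2 * ((cmod (h z))\<^sup>2 * exp (- (cmod z)\<^sup>2)) + M\<^sup>2 * exp (- (cmod z)\<^sup>2 / 2)"
    proof (cases "cmod z \<le> R")
      case True
      have "(cmod (G z))\<^sup>2 * exp (- (cmod z)\<^sup>2) \<le> M\<^sup>2 * exp (- (cmod z)\<^sup>2 / 2)"
        using M[OF True] by (intro mult_mono power_mono) auto
      then show ?thesis by (simp add: add_increasing)
    next
      case False
      then have "(cmod (G z))\<^sup>2 * exp (- (cmod z)\<^sup>2) \<le> (B * cmod (h z))\<^sup>2 * exp (- (cmod z)\<^sup>2)"
        using le[of z] by (intro mult_right_mono power_mono) auto
      then show ?thesis by (simp add: add_increasing2 power_mult_distrib mult_ac)
    qed
  qed
qed

section \<open>Series of normalized reproducing kernels\<close>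

text \<open>
  The reproducing kernel at \<open>a\<close> divided by its norm.
\<close>

definition normalized_kernel :: "complex \<Rightarrow> complex \<Rightarrow> complex" where
  "normalized_kernel a z = exp (z * cnj a - of_real ((cmod a)\<^sup>2 / 2))"

text \<open>
  Measured against the growth rate of point evaluations, the kernel at \<open>a\<close> is a bump of height 1
  concentrated near \<open>a\<close>. Hence kernels at distant points hardly interact.
\<close>

lemma norm_normalized_kernel:
  "cmod (normalized_kernel a z) = exp ((cmod z)\<^sup>2 / 2) * exp (- (cmod (z - a))\<^sup>2 / 2)"
proof -
  have "Re (z * cnj a) - (cmod a)\<^sup>2 / 2 = (cmod z)\<^sup>2 / 2 + - (cmod (z - a))\<^sup>2 / 2"
    by (simp add: cmod_power2) (simp add: power2_eq_square field_simps)
  then show ?thesis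
    by (simp add: normalized_kernel_def norm_exp_eq_Re flip: exp_add)
qed

lemma norm_normalized_kernel_le: "cmod (normalized_kernel a z) \<le> exp ((cmod z)\<^sup>2 / 2)"
  by (simp add: norm_normalized_kernel)

lemma summable_kernel_series:
  assumes "summable (\<lambda>j. cmod (d j))"
  shows "summable (\<lambda>j. cmod (d j * normalized_kernel (a j) z))"
proof (rule summable_comparison_test'[of "\<lambda>j. cmod (d j) * exp ((cmod z)\<^sup>2 / 2)" 0])
  show "norm (cmod (d j * normalized_kernel (a j) z)) \<le> cmod (d j) * exp ((cmod z)\<^sup>2 / 2)" for j
    by (simp add: norm_mult mult_left_mono norm_normalized_kernel_le)
qed (use assms in \<open>auto intro: summable_mult2\<close>)

lemma kernel_series_in_fock:
  assumes d: "summable (\<lambda>j. cmod (d j))"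
  shows "(\<lambda>z. \<Sum>j. d j * normalized_kernel (a j) z) \<in> fock_space"
proof (rule fock_spaceI)
  show "(\<lambda>z. \<Sum>j. d j * normalized_kernel (a j) z) holomorphic_on UNIV"
  proof (rule holomorphic_uniform_sequence)
    show "(\<lambda>z. \<Sum>j<n. d j * normalized_kernel (a j) z) holomorphic_on UNIV" for n
      unfolding normalized_kernel_def by (intro holomorphic_intros)
    fix x :: complex
    define M where "M = exp ((cmod x + 1)\<^sup>2 / 2)"
    have "uniform_limit (cball x 1) (\<lambda>n z. \<Sum>j<n. d j * normalized_kernel (a j) z)
        (\<lambda>z. \<Sum>j. d j * normalized_kernel (a j) z) sequentially"
    proof (rule Weierstrass_m_test)
      fix j z assume "z \<in> cball x 1"
      then have "cmod z \<le> cmod x + 1"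
        using norm_triangle_ineq2[of z x] by (simp add: dist_norm norm_minus_commute)
      then have "cmod (normalized_kernel (a j) z) \<le> M"
        unfolding M_def using norm_normalized_kernel_le[of "a j" z]
        by (meson divide_right_mono exp_le_cancel_iff norm_ge_zero order_trans power_mono zero_le_numeral)
      then show "norm (d j * normalized_kernel (a j) z) \<le> cmod (d j) * M"
        by (simp add: norm_mult mult_left_mono)
    qed (use d in \<open>auto intro: summable_mult2\<close>)
    then show "\<exists>e>0. cball x e \<subseteq> UNIV \<and> uniform_limit (cball x e) (\<lambda>n z. \<Sum>j<n. d j * normalized_kernel (a j) z)
        (\<lambda>z. \<Sum>j. d j * normalized_kernel (a j) z) sequentially"
      by (intro exI[of _ 1]) auto
  qed auto
  \<comment> \<open>The series of bumps X is integrable and bounded by T,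
    so that X * X, which dominates the integrand, is dominated by T * X.\<close>
  define T where "T = (\<Sum>j. cmod (d j))"
  define X where "X z = (\<Sum>j. cmod (d j) * exp (- (cmod (z - a j))\<^sup>2 / 2))" for z
  have shift: "integrable lborel (\<lambda>z. exp (- (cmod (z - b))\<^sup>2 / 2))"
    "(LINT z|lborel. exp (- (cmod (z - b))\<^sup>2 / 2)) = (LINT z|lborel. exp (- (cmod z)\<^sup>2 / 2))" for b
  proof -
    have eq: "lborel = distr lborel borel ((+) (- b))" by (rule lborel_distr_plus[symmetric])
    show "integrable lborel (\<lambda>z. exp (- (cmod (z - b))\<^sup>2 / 2))"
      using gaussian_integrable by (subst (asm) eq, subst (asm) integrable_distr_eq) auto
    show "(LINT z|lborel. exp (- (cmod (z - b))\<^sup>2 / 2)) = (LINT z|lborel. exp (- (cmod z)\<^sup>2 / 2))"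
      by (subst (2) eq, subst integral_distr) auto
  qed
  have sX: "summable (\<lambda>j. cmod (d j) * exp (- (cmod (z - a j))\<^sup>2 / 2))" for z
    by (rule summable_comparison_test'[OF d, of 0]) (auto intro: mult_left_le)
  have "integrable lborel X"
    unfolding X_def
  proof (rule integrable_suminf)
    show "integrable lborel (\<lambda>z. cmod (d j) * exp (- (cmod (z - a j))\<^sup>2 / 2))" for j
      by (intro integrable_mult_right shift)
    show "AE z in lborel. summable (\<lambda>j. norm (cmod (d j) * exp (- (cmod (z - a j))\<^sup>2 / 2)))"
      using sX by simp
    show "summable (\<lambda>j. LINT z|lborel. norm (cmod (d j) * exp (- (cmod (z - a j))\<^sup>2 / 2)))"
      using summable_mult2[OF d] by (simp add: shift(2)[simplified])
  qed
  then show "integrable lborel (\<lambda>z. T * X z)" by simp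
  fix z
  have X0: "X z \<ge> 0" unfolding X_def by (intro suminf_nonneg sX) auto
  have XT: "X z \<le> T"
    unfolding X_def T_def by (intro suminf_le sX d) (auto intro: mult_left_le)
  have "cmod (\<Sum>j. d j * normalized_kernel (a j) z) \<le> (\<Sum>j. cmod (d j * normalized_kernel (a j) z))"
    by (intro summable_norm summable_kernel_series d)
  also have "\<dots> = (\<Sum>j. exp ((cmod z)\<^sup>2 / 2) * (cmod (d j) * exp (- (cmod (z - a j))\<^sup>2 / 2)))"
    by (simp add: norm_mult norm_normalized_kernel mult_ac)
  also have "\<dots> = exp ((cmod z)\<^sup>2 / 2) * X z"
    unfolding X_def by (rule suminf_mult[OF sX])
  finally have "(cmod (\<Sum>j. d j * normalized_kernel (a j) z))\<^sup>2 * exp (- (cmod z)\<^sup>2)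
     \<le> (exp ((cmod z)\<^sup>2 / 2) * X z)\<^sup>2 * exp (- (cmod z)\<^sup>2)"
    by (intro mult_right_mono power_mono) auto
  also have "\<dots> = X z * X z"
    by (simp add: power_mult_distrib exp_double[symmetric] exp_minus) (simp add: power2_eq_square)
  also have "\<dots> \<le> T * X z"
    using X0 XT by (rule mult_right_mono[rotated])
  finally show "(cmod (\<Sum>j. d j * normalized_kernel (a j) z))\<^sup>2 * exp (- (cmod z)\<^sup>2) \<le> T * X z" .
qed

section \<open>Subspaces of finite codimension\<close>

lemma underdetermined_system_solution:
  fixes C :: "'b \<Rightarrow> nat \<Rightarrow> 'a::field"
  assumes "finite I" "m < card I"
  shows "\<exists>a. (\<exists>i\<in>I. a i \<noteq> 0) \<and> (\<forall>j<m. (\<Sum>i\<in>I. a i * C i j) = 0)"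
  using assms
proof (induction m arbitrary: I C)
  case 0
  then obtain i where "i \<in> I" by fastforce
  then show ?case by (intro exI[of _ "\<lambda>_. 1"]) auto
next
  case (Suc m)
  show ?case
  proof (cases "\<forall>i\<in>I. C i m = 0")
    case True
    with Suc.IH[of I C] Suc.prems show ?thesis
      by (auto simp: less_Suc_eq)
  next
    case False
    then obtain k where k: "k \<in> I" "C k m \<noteq> 0" by auto
    define J where "J = I - {k}"
    have J: "finite J" "m < card J" "k \<notin> J" "I = insert k J"
      using Suc.prems k by (auto simp: J_def)
    obtain a where a: "\<exists>i\<in>J. a i \<noteq> 0"
      and a0: "\<And>j. j < m \<Longrightarrow> (\<Sum>i\<in>J. a i * (C i j - C i m / C k m * C k j)) = 0"
      using Suc.IH[OF J(1,2), of "\<lambda>i j. C i j - C i m / C k m * C k j"] by auto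
    define c where "c = - (\<Sum>i\<in>J. a i * C i m) / C k m"
    define a' where "a' = a(k := c)"
    have sum: "(\<Sum>i\<in>I. a' i * C i j) = c * C k j + (\<Sum>i\<in>J. a i * C i j)" for j
    proof -
      have "(\<Sum>i\<in>J. a' i * C i j) = (\<Sum>i\<in>J. a i * C i j)"
        using J by (intro sum.cong) (auto simp: a'_def)
      then show ?thesis using J by (simp add: a'_def)
    qed
    have "(\<Sum>i\<in>I. a' i * C i j) = 0" if "j < Suc m" for j
    proof (cases "j = m")
      case True
      then show ?thesis using k by (simp add: sum c_def)
    next
      case False
      then have "(\<Sum>i\<in>J. a i * C i j) - (\<Sum>i\<in>J. a i * (C i m / C k m * C k j)) = 0"
        using a0[of j] that by (simp add: right_diff_distrib sum_subtractf)
      moreover have "(\<Sum>i\<in>J. a i * (C i m / C k m * C k j)) = - c * C k j"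
        by (simp add: c_def sum_divide_distrib sum_distrib_right mult.assoc)
      ultimately show ?thesis by (simp add: sum)
    qed
    moreover have "\<exists>i\<in>I. a' i \<noteq> 0"
      using a J by (auto simp: a'_def)
    ultimately show ?thesis by blast
  qed
qed

lemma closed_subspace_combination:
  assumes E: "closed_subspace H N E" and "finite I" "\<And>i. i \<in> I \<Longrightarrow> e i \<in> E"
  shows "(\<lambda>z. \<Sum>i\<in>I. a i * e i z) \<in> E"
proof -
  have zero: "(\<lambda>z. 0) \<in> E"
    and add: "\<And>f g. f \<in> E \<Longrightarrow> g \<in> E \<Longrightarrow> (\<lambda>z. f z + g z) \<in> E"
    and cmult: "\<And>c f. f \<in> E \<Longrightarrow> (\<lambda>z. c * f z) \<in> E"
    using E unfolding closed_subspace_def by blast+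
  from assms(2,3) show ?thesis
  proof (induction I rule: finite_induct)
    case empty
    show ?case using zero by simp
  next
    case (insert i I)
    have "(\<lambda>z. a i * e i z + (\<Sum>i\<in>I. a i * e i z)) \<in> E"
      using insert by (intro add[OF cmult]) auto
    then show ?case using insert by simp
  qed
qed

text \<open>
  Modulo \<open>E\<close>, the \<open>m + 1\<close> vectors \<open>h i\<close> lie in a space of dimension \<open>m\<close>.
\<close>

lemma finite_codimension_combination:
  assumes E: "closed_subspace H N E" and codim: "has_codimension H E m"
    and h: "\<And>i. i \<le> m \<Longrightarrow> h i \<in> H"
  obtains a where "\<exists>i\<le>m. a i \<noteq> 0" "(\<lambda>z. \<Sum>i\<le>m. a i * h i z) \<in> E"
proof -
  obtain b where "\<forall>h\<in>H. \<exists>c. (\<lambda>z. h z - (\<Sum>j<m. c j * b j z)) \<in> E"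
    using codim by (auto simp: has_codimension_def)
  then have "\<forall>i. \<exists>c. i \<le> m \<longrightarrow> (\<lambda>z. h i z - (\<Sum>j<m. c j * b j z)) \<in> E"
    using h by blast
  then obtain C where C: "\<And>i. i \<le> m \<Longrightarrow> (\<lambda>z. h i z - (\<Sum>j<m. C i j * b j z)) \<in> E"
    by metis
  obtain a where a: "\<exists>i\<in>{..m}. a i \<noteq> 0" and a0: "\<And>j. j < m \<Longrightarrow> (\<Sum>i\<le>m. a i * C i j) = 0"
    using underdetermined_system_solution[of "{..m}" m C] by auto
  have "(\<lambda>z. \<Sum>i\<le>m. a i * (h i z - (\<Sum>j<m. C i j * b j z))) \<in> E"
    using C by (intro closed_subspace_combination[OF E]) auto
  also have "(\<lambda>z. \<Sum>i\<le>m. a i * (h i z - (\<Sum>j<m. C i j * b j z))) = (\<lambda>z. \<Sum>i\<le>m. a i * h i z)"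
  proof
    fix z
    have "(\<Sum>i\<le>m. a i * (\<Sum>j<m. C i j * b j z)) = (\<Sum>j<m. (\<Sum>i\<le>m. a i * C i j) * b j z)"
      unfolding sum_distrib_left sum_distrib_right by (subst sum.swap) (simp add: mult_ac)
    also have "\<dots> = 0" using a0 by simp
    finally show "(\<Sum>i\<le>m. a i * (h i z - (\<Sum>j<m. C i j * b j z))) = (\<Sum>i\<le>m. a i * h i z)"
      by (simp add: right_diff_distrib sum_subtractf)
  qed
  finally have "(\<lambda>z. \<Sum>i\<le>m. a i * h i z) \<in> E" .
  moreover have "\<exists>i\<le>m. a i \<noteq> 0" using a by auto
  ultimately show thesis by (rule that[rotated])
qed

text \<open>
  At the centre of the \<open>j\<close>-th kernel the \<open>j\<close>-th term dominates, if the other centres are so far away that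
  their bumps have height at most \<open>\<epsilon>\<close> there.
\<close>

lemma kernel_series_lower_bound:
  assumes d: "\<And>k. cmod (d k) \<le> A * (1 / 2) ^ k"
    and sep: "\<And>k. k \<noteq> j \<Longrightarrow> exp (- (cmod (a j - a k))\<^sup>2 / 2) \<le> \<epsilon>"
  shows "exp ((cmod (a j))\<^sup>2 / 2) * (cmod (d j) - 2 * A * \<epsilon>)
    \<le> cmod (\<Sum>k. d k * normalized_kernel (a k) (a j))"
proof -
  let ?W = "exp ((cmod (a j))\<^sup>2 / 2)"
  have geo: "(\<lambda>k. (1 / 2 :: real) ^ k) sums 2"
    using geometric_sums[of "1/2 :: real"] by simp
  have sd: "summable (\<lambda>k. cmod (d k))"
  proof (rule summable_comparison_test'[of "\<lambda>k. A * (1 / 2) ^ k" 0])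
    show "summable (\<lambda>k. A * (1 / 2) ^ k)"
      by (intro summable_mult sums_summable[OF geo])
  qed (simp add: d)
  define t where "t k = d k * normalized_kernel (a k) (a j)" for k
  have st: "summable t"
    unfolding t_def by (rule summable_norm_cancel[OF summable_kernel_series[OF sd]])
  define r where "r k = (if k = j then 0 else t k)" for k
  have "(\<lambda>k. if k = j then t j else 0) sums t j" by (rule sums_single)
  then have "(\<lambda>k. t k - (if k = j then t j else 0)) sums (suminf t - t j)"
    by (intro sums_diff summable_sums st)
  then have r: "r sums (suminf t - t j)"
    by (rule sums_cong[THEN iffD1, rotated]) (simp add: r_def)
  have rle: "cmod (r k) \<le> A * \<epsilon> * ?W * (1 / 2) ^ k" for k
  proof (cases "k = j")
    case True
    have "0 \<le> A" using order_trans[OF norm_ge_zero d[of 0]] by simp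
    moreover have "0 \<le> \<epsilon>" using order_trans[OF exp_ge_zero sep[of "Suc j"]] by simp
    ultimately show ?thesis using True by (simp add: r_def)
  next
    case False
    have "cmod (r k) = ?W * (cmod (d k) * exp (- (cmod (a j - a k))\<^sup>2 / 2))"
      using False by (simp add: r_def t_def norm_mult norm_normalized_kernel)
    also have "\<dots> \<le> ?W * ((A * (1 / 2) ^ k) * \<epsilon>)"
    proof (intro mult_left_mono mult_mono d sep False)
      show "0 \<le> A * (1 / 2) ^ k" by (rule order_trans[OF norm_ge_zero d])
    qed auto
    finally show ?thesis by (simp add: mult_ac)
  qed
  have "cmod (suminf r) \<le> A * \<epsilon> * ?W * 2"
  proof -
    have s: "(\<lambda>k. A * \<epsilon> * ?W * (1 / 2) ^ k) sums (A * \<epsilon> * ?W * 2)"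
      by (rule sums_mult[OF geo])
    show ?thesis
      using norm_suminf_le[OF rle sums_summable[OF s]] sums_unique[OF s] by simp
  qed
  moreover have "suminf r = suminf t - t j" using r by (rule sums_unique[symmetric])
  moreover have "cmod (t j) = ?W * cmod (d j)"
    by (simp add: t_def norm_mult norm_normalized_kernel)
  ultimately have "?W * cmod (d j) - A * \<epsilon> * ?W * 2 \<le> cmod (suminf t)"
    using norm_triangle_ineq2[of "t j" "suminf t"] norm_minus_commute[of "t j" "suminf t"] by simp
  then show ?thesis by (simp add: t_def[abs_def] algebra_simps)
qed

section \<open>Multipliers on a subspace of finite codimension are bounded near infinity\<close>

lemma sparse_sequence:
  assumes "\<And>R n. \<exists>z. P n z \<and> R \<le> cmod z"
  obtains a :: "nat \<Rightarrow> complex" where "\<And>n. P n (a n)"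
    and "\<And>j k. j \<noteq> k \<Longrightarrow> 2 * real j \<le> cmod (a j - a k)"
proof -
  have "\<exists>a. \<forall>n. P n (a n) \<and> cmod (a n) + 2 * real (Suc n) \<le> cmod (a (Suc n))"
    by (rule dependent_nat_choice[where Q = "\<lambda>n x y. cmod x + 2 * real (Suc n) \<le> cmod y"])
       (use assms in blast)+
  then obtain a where a: "\<And>n. P n (a n)" and step: "\<And>n. cmod (a n) + 2 * real (Suc n) \<le> cmod (a (Suc n))"
    by blast
  have less: "cmod (a j) + 2 * real k \<le> cmod (a k)" if "j < k" for j k
  proof -
    from that obtain n where n: "k = Suc n" "j \<le> n" by (cases k) auto
    have "cmod (a j) \<le> cmod (a n)"
      by (rule lift_Suc_mono_le[OF _ n(2)], rule order_trans[OF _ step]) simp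
    with step[of n] show ?thesis by (simp add: n)
  qed
  have "2 * real j \<le> cmod (a j - a k)" if "j \<noteq> k" for j k
  proof (cases "j < k")
    case True
    from less[OF True] True norm_triangle_ineq2[of "a k" "a j"] show ?thesis
      by (simp add: norm_minus_commute)
  next
    case False
    with less[of k j] that norm_triangle_ineq2[of "a j" "a k"] show ?thesis by simp
  qed
  with a that show thesis by blast
qed

text \<open>
  If \<open>\<psi>\<close> were unbounded near infinity, there would be sparse points \<open>a j\<close> at which \<open>\<psi>\<close> has size at
  least \<open>4 ^ j\<close>. A series of kernels at these points with coefficients of size \<open>2 ^ (- j)\<close> lies in the Fock
  space, but multiplied by \<open>\<psi>\<close> it grows at the points \<open>a j\<close> faster than the pointwise bound permits.
  This persists on a subspace \<open>E\<close> of codimension \<open>m\<close>: split the indices into \<open>m + 1\<close> residue classes.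
  Some nontrivial linear combination of the \<open>m + 1\<close> partial series lies in \<open>E\<close>, and
  it is still too large along one of the classes.
\<close>

lemma multiplier_bounded_near_infinity:
  assumes E: "closed_subspace fock_space N E" and codim: "has_codimension fock_space E m"
    and mult: "\<And>h. h \<in> E \<Longrightarrow> \<exists>g\<in>fock_space. \<forall>z\<in>D. g z = \<psi> z * h z"
  obtains R B where "\<And>z. z \<in> D \<Longrightarrow> R \<le> cmod z \<Longrightarrow> cmod (\<psi> z) \<le> B"
proof (rule ccontr)
  assume "\<not> thesis"
  with that have "\<exists>z. (z \<in> D \<and> 4 ^ n \<le> cmod (\<psi> z)) \<and> R \<le> cmod z" for n :: nat and R
    by (meson linear)
  then obtain a where aD: "\<And>j. a j \<in> D" and big: "\<And>j. 4 ^ j \<le> cmod (\<psi> (a j))"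
    and sep: "\<And>j k. j \<noteq> k \<Longrightarrow> 2 * real j \<le> cmod (a j - a k)"
    using sparse_sequence[of "\<lambda>n z. z \<in> D \<and> 4 ^ n \<le> cmod (\<psi> z)"] by metis
  define M where "M = Suc m"
  define d where "d i j = (if j mod M = i then (1 / 2) ^ j else 0 :: complex)" for i j
  define h where "h i z = (\<Sum>j. d i j * normalized_kernel (a j) z)" for i z
  have sd: "summable (\<lambda>j. cmod (d i j))" for i
  proof (rule summable_comparison_test'[of "\<lambda>j. (1 / 2 :: real) ^ j" 0])
    show "norm (cmod (d i j)) \<le> (1 / 2) ^ j" for j
      by (simp add: d_def norm_power)
  qed (simp add: summable_geometric)
  have "h i \<in> fock_space" for i
    unfolding h_def by (rule kernel_series_in_fock[OF sd])
  then obtain c where c: "\<exists>i\<le>m. c i \<noteq> 0" and hE: "(\<lambda>z. \<Sum>i\<le>m. c i * h i z) \<in> E"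
    using finite_codimension_combination[OF E codim] by metis
  define H where "H z = (\<Sum>j. (c (j mod M) * (1 / 2) ^ j) * normalized_kernel (a j) z)" for z
  have H: "(\<Sum>i\<le>m. c i * h i z) = H z" for z
  proof -
    have s: "summable (\<lambda>j. d i j * normalized_kernel (a j) z)" for i
      by (rule summable_norm_cancel[OF summable_kernel_series[OF sd]])
    have "(\<Sum>i\<le>m. c i * h i z) = (\<Sum>j. \<Sum>i\<le>m. c i * (d i j * normalized_kernel (a j) z))"
      unfolding h_def using s by (simp add: suminf_sum suminf_mult summable_mult)
    also have "\<dots> = H z"
      unfolding H_def
    proof (rule suminf_cong)
      fix j
      have "(\<Sum>i\<le>m. c i * (d i j * normalized_kernel (a j) z))
        = (\<Sum>i\<le>m. if i = j mod M then c (j mod M) * (1 / 2) ^ j * normalized_kernel (a j) z else 0)"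
        by (intro sum.cong) (auto simp: d_def)
      also have "\<dots> = c (j mod M) * (1 / 2) ^ j * normalized_kernel (a j) z"
        using mod_less_divisor[of M j] by (simp add: M_def less_Suc_eq_le)
      finally show "(\<Sum>i\<le>m. c i * (d i j * normalized_kernel (a j) z))
        = c (j mod M) * (1 / 2) ^ j * normalized_kernel (a j) z" .
    qed
    finally show ?thesis .
  qed
  obtain g where g: "g \<in> fock_space" and gD: "\<And>z. z \<in> D \<Longrightarrow> g z = \<psi> z * H z"
    using mult[OF hE] by (auto simp: H)
  obtain K where K: "\<And>f z. f \<in> fock_space \<Longrightarrow> cmod (f z) \<le> K * exp ((cmod z)\<^sup>2 / 2) * fock_norm f"
    using fock_pointwise_bound by metis
  obtain i where i: "i \<le> m" "c i \<noteq> 0" using c by blast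
  define A where "A = (\<Sum>i\<le>m. cmod (c i))"
  \<comment> \<open>Along the class of i the weighted values of g grow like 2 ^ j * cmod (c i), up to the error 2 * A
    caused by all the other kernels; the pointwise bound caps them by K * fock_norm g.\<close>
  have bound: "real n * cmod (c i) \<le> 2 * A + K * fock_norm g" for n
  proof -
    define j where "j = i + M * n"
    have jmod: "j mod M = i" using i by (simp add: j_def M_def del: mult_Suc)
    have "n \<le> j" by (simp add: j_def M_def)
    let ?W = "exp ((cmod (a j))\<^sup>2 / 2)"
    have "?W * (cmod (c (j mod M) * (1 / 2) ^ j) - 2 * A * (1 / 4) ^ j)
      \<le> cmod (\<Sum>k. (c (k mod M) * (1 / 2) ^ k) * normalized_kernel (a k) (a j))"
    proof (rule kernel_series_lower_bound)
      fix k
      have "cmod (c (k mod M)) \<le> A"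
        unfolding A_def using mod_less_divisor[of M k]
        by (intro member_le_sum) (auto simp: M_def less_Suc_eq_le)
      then show "cmod (c (k mod M) * (1 / 2) ^ k) \<le> A * (1 / 2) ^ k"
        by (simp add: norm_mult norm_power mult_right_mono)
    next
      fix k assume "k \<noteq> j"
      then have "4 * (real j)\<^sup>2 \<le> (cmod (a j - a k))\<^sup>2"
        using sep[of j k] power_mono[of "2 * real j" _ 2] by (simp add: power_mult_distrib)
      moreover have "real j \<le> (real j)\<^sup>2"
        by (cases j) (simp_all add: power2_eq_square)
      ultimately have "4 * real j \<le> (cmod (a j - a k))\<^sup>2"
        by linarith
      then have "exp (- (cmod (a j - a k))\<^sup>2 / 2) \<le> exp (real j * (-2))"
        by simp
      also have "\<dots> = exp (-2) ^ j" by (rule exp_of_nat_mult)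
      also have "\<dots> \<le> (1 / 4) ^ j"
      proof (rule power_mono)
        have "(2::real) ^ 2 \<le> exp 1 ^ 2"
          using exp_ge_add_one_self[of 1] by (intro power_mono) auto
        then show "exp (-2) \<le> (1 / 4 :: real)"
          by (simp add: exp_minus field_simps flip: exp_of_nat_mult)
      qed simp
      finally show "exp (- (cmod (a j - a k))\<^sup>2 / 2) \<le> (1 / 4) ^ j" .
    qed
    then have "?W * (cmod (c i) * (1 / 2) ^ j - 2 * A * (1 / 4) ^ j) \<le> cmod (H (a j))"
      by (simp add: H_def jmod norm_mult norm_power)
    then have "4 ^ j * (?W * (cmod (c i) * (1 / 2) ^ j - 2 * A * (1 / 4) ^ j)) \<le> 4 ^ j * cmod (H (a j))"
      by (rule mult_left_mono) simp
    also have "\<dots> \<le> cmod (\<psi> (a j)) * cmod (H (a j))"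
      using big by (rule mult_right_mono) simp
    also have "\<dots> = cmod (g (a j))" by (simp add: gD aD norm_mult)
    also have "\<dots> \<le> ?W * (K * fock_norm g)"
      using K[OF g, of "a j"] by (simp add: mult_ac)
    also have "4 ^ j * (?W * (cmod (c i) * (1 / 2) ^ j - 2 * A * (1 / 4) ^ j))
      = ?W * (cmod (c i) * (4 * (1 / 2)) ^ j - 2 * A * (4 * (1 / 4)) ^ j)"
      unfolding power_mult_distrib by (simp add: algebra_simps)
    finally have "cmod (c i) * 2 ^ j - 2 * A \<le> K * fock_norm g" by simp
    moreover have "real n \<le> 2 ^ j"
      using \<open>n \<le> j\<close> of_nat_less_two_power[of j, where ?'a = real] by linarith
    then have "real n * cmod (c i) \<le> 2 ^ j * cmod (c i)" by (rule mult_right_mono) simp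
    ultimately show ?thesis by (simp add: mult.commute)
  qed
  obtain n where "2 * A + K * fock_norm g < real n * cmod (c i)"
    using ex_less_of_nat_mult[of "cmod (c i)"] i by auto
  with bound[of n] show False by simp
qed

section \<open>Rational functions near infinity and near their poles\<close>

lemma poly_nonzero_near_infinity:
  fixes p :: "complex poly"
  assumes "p \<noteq> 0"
  shows "eventually (\<lambda>z. poly p z \<noteq> 0) at_infinity"
proof -
  have "finite {z. poly p z = 0}" using assms by (rule poly_roots_finite)
  then obtain R where "\<And>z. poly p z = 0 \<Longrightarrow> cmod z \<le> R"
    by (meson finite_imp_bounded bounded_iff mem_Collect_eq)
  then show ?thesis
    unfolding eventually_at_infinity
    by (intro exI[of _ "R + 1"]) (metis add_le_same_cancel1 not_one_le_zero order_trans)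
qed

text \<open>
  Boundedness forces the degree of \<open>p\<close> to be at most that of \<open>q\<close>, for otherwise \<open>q / p\<close> would tend to 0.
\<close>

lemma bounded_quotient_tendsto_at_infinity:
  fixes p q :: "complex poly"
  assumes q: "q \<noteq> 0" and le: "\<And>z. R \<le> cmod z \<Longrightarrow> cmod (poly p z) \<le> B * cmod (poly q z)"
  obtains l where "((\<lambda>z. poly p z / poly q z) \<longlongrightarrow> l) at_infinity"
proof -
  have nz: "eventually (\<lambda>z. poly q z \<noteq> 0) at_infinity"
    using q by (rule poly_nonzero_near_infinity)
  consider "degree p < degree q" | "degree p = degree q" | "degree q < degree p"
    by linarith
  then show thesis
  proof cases
    case 1
    then show ?thesis using poly_divide_tendsto_0_at_infinity that by blast
  next
    case 2
    define c where "c = lead_coeff p / lead_coeff q"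
    define r where "r = p - smult c q"
    have "coeff r (degree q) = 0"
      using q 2 by (simp add: r_def c_def)
    moreover have "degree r \<le> degree q"
      using 2 unfolding r_def by (intro degree_diff_le) auto
    ultimately have "degree r < degree q \<or> r = 0"
      by (metis leading_coeff_0_iff le_neq_implies_less)
    then have "((\<lambda>z. poly r z / poly q z) \<longlongrightarrow> 0) at_infinity"
      using poly_divide_tendsto_0_at_infinity by auto
    then have "((\<lambda>z. poly r z / poly q z + c) \<longlongrightarrow> 0 + c) at_infinity"
      by (intro tendsto_add tendsto_const)
    moreover have "eventually (\<lambda>z. poly r z / poly q z + c = poly p z / poly q z) at_infinity"
      using nz by eventually_elim (simp add: r_def field_simps)
    ultimately have "((\<lambda>z. poly p z / poly q z) \<longlongrightarrow> 0 + c) at_infinity"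
      by (rule Lim_transform_eventually)
    then show ?thesis using that by blast
  next
    case 3
    then have p: "p \<noteq> 0" by auto
    have "((\<lambda>z. B * cmod (poly q z / poly p z)) \<longlongrightarrow> B * cmod 0) at_infinity"
      by (intro tendsto_mult tendsto_const tendsto_norm poly_divide_tendsto_0_at_infinity 3)
    then have "eventually (\<lambda>z. B * cmod (poly q z / poly p z) < 1) at_infinity"
      by (rule order_tendstoD) simp
    moreover have "eventually (\<lambda>z::complex. R \<le> cmod z) at_infinity"
      unfolding eventually_at_infinity by blast
    ultimately have "eventually (\<lambda>z::complex. False) at_infinity"
      using poly_nonzero_near_infinity[OF p]
    proof eventually_elim
      case (elim z)
      then show False using le[of z] by (simp add: norm_divide field_simps)
    qed
    then show ?thesis by (simp add: eventually_False trivial_limit_at_infinity)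
  qed
qed

lemma norm_poly_le_power:
  fixes p :: "complex poly"
  obtains K where "\<And>z. 1 \<le> cmod z \<Longrightarrow> cmod (poly p z) \<le> K * cmod z ^ degree p"
proof (rule that)
  fix z assume z: "1 \<le> cmod z"
  have "cmod (poly p z) \<le> (\<Sum>i\<le>degree p. cmod (coeff p i * z ^ i))"
    unfolding poly_altdef by (rule norm_sum)
  also have "\<dots> \<le> (\<Sum>i\<le>degree p. cmod (coeff p i) * cmod z ^ degree p)"
    using z by (intro sum_mono) (auto simp: norm_mult norm_power intro!: mult_left_mono power_increasing)
  finally show "cmod (poly p z) \<le> (\<Sum>i\<le>degree p. cmod (coeff p i)) * cmod z ^ degree p"
    by (simp add: sum_distrib_right)
qed

text \<open>
  This is Liouville's theorem for functions of polynomial growth.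
\<close>

lemma entire_dominated_by_poly:
  assumes f: "f holomorphic_on UNIV"
    and le: "\<And>z. R \<le> cmod z \<Longrightarrow> cmod (f z) \<le> B * cmod (poly p z)"
  obtains q where "f = poly q"
proof -
  obtain K where K: "\<And>z. 1 \<le> cmod z \<Longrightarrow> cmod (poly p z) \<le> K * cmod z ^ degree p"
    using norm_poly_le_power by blast
  have "f z = (\<Sum>k\<le>degree p. (deriv ^^ k) f 0 / fact k * z ^ k)" for z
  proof (rule Liouville_polynomial[OF f])
    fix z assume z: "max R 1 \<le> cmod z"
    have "cmod (f z) \<le> B * cmod (poly p z)" using z le by simp
    also have "\<dots> \<le> \<bar>B\<bar> * cmod (poly p z)" by (intro mult_right_mono) auto
    also have "\<dots> \<le> \<bar>B\<bar> * (K * cmod z ^ degree p)" using z K by (intro mult_left_mono) auto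
    finally show "cmod (f z) \<le> (\<bar>B\<bar> * K) * cmod z ^ degree p" by (simp add: mult.assoc)
  qed
  then have "f = poly (\<Sum>k\<le>degree p. monom ((deriv ^^ k) f 0 / fact k) k)"
    by (simp add: fun_eq_iff poly_sum poly_monom)
  then show thesis by (rule that)
qed

lemma remove_sings_rational:
  fixes p q :: "complex poly"
  assumes "poly q z \<noteq> 0"
  shows "remove_sings (\<lambda>w. poly p w / poly q w) z = poly p z / poly q z"
    and "\<not> is_pole (\<lambda>w. poly p w / poly q w) z"
proof -
  have "(\<lambda>w. poly p w / poly q w) analytic_on {z}"
  proof (rule analytic_on_divide)
    have "poly r analytic_on UNIV" for r :: "complex poly"
      using fock_spaceD(1)[OF fock_poly] by (simp add: analytic_on_open)
    then show "poly p analytic_on {z}" "poly q analytic_on {z}"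
      using analytic_on_subset by blast+
  qed (use assms in auto)
  then show "remove_sings (\<lambda>w. poly p w / poly q w) z = poly p z / poly q z"
    and "\<not> is_pole (\<lambda>w. poly p w / poly q w) z"
    by (simp_all add: analytic_at_imp_no_pole)
qed

lemma eventually_cofinite_nhd:
  assumes "finite (S :: complex set)"
  shows "eventually (\<lambda>w. w \<notin> S) (at z)"
proof -
  have "open (- (S - {z}))" using assms by (intro open_Compl finite_imp_closed) auto
  then have "eventually (\<lambda>w. w \<in> - (S - {z}) - {z}) (at z)"
    by (intro eventually_at_in_open) auto
  then show ?thesis by eventually_elim auto
qed

text \<open>
  Near \<open>z\<close> the quotient \<open>q / p\<close> equals \<open>g / h\<close>, where \<open>h\<close> and \<open>g\<close> witness the singularity. There
  \<open>h\<close> tends to 0 while \<open>g\<close> does not.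
\<close>

lemma singularity_is_pole:
  fixes p q :: "complex poly"
  assumes p: "p \<noteq> 0" and fin: "finite (- D)"
    and \<psi>: "\<And>z. z \<in> D \<Longrightarrow> poly q z = \<psi> z * poly p z"
    and sing: "singularity fock_space D \<psi> z"
  shows "is_pole (\<lambda>w. poly q w / poly p w) z"
proof -
  obtain h g where h: "h \<in> fock_space" "h z = 0" and g: "g \<in> fock_space" "g z \<noteq> 0"
    and gh: "\<And>w. w \<in> D \<Longrightarrow> g w = \<psi> w * h w"
    using sing unfolding singularity_def by blast
  have cont: "isCont f w" if "f \<in> fock_space" for f w
    using holomorphic_on_imp_continuous_on[OF fock_spaceD(1)[OF that]]
    by (simp add: continuous_on_eq_continuous_at)
  have "g \<midarrow>z\<rightarrow> g z" using cont[OF g(1)] by (simp add: isCont_def)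
  then have "eventually (\<lambda>w. g w \<noteq> 0) (at z)" using g(2) by (rule tendsto_imp_eventually_ne)
  moreover have "eventually (\<lambda>w. w \<notin> - D \<union> {w. poly p w = 0}) (at z)"
    using fin poly_roots_finite[OF p] by (intro eventually_cofinite_nhd) auto
  ultimately have ev: "eventually (\<lambda>w. h w \<noteq> 0 \<and> g w / h w = poly q w / poly p w) (at z)"
    by eventually_elim (auto simp: gh \<psi>)
  have "is_pole (\<lambda>w. g w / h w) z"
  proof (rule is_pole_divide)
    show "isCont g z" by (rule cont[OF g(1)])
    have "h \<midarrow>z\<rightarrow> 0" using cont[OF h(1), of z] h(2) by (simp add: isCont_def)
    then show "filterlim h (at 0) (at z)"
      using ev by (auto simp: filterlim_at elim: eventually_mono)
  qed (rule g(2))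
  then show ?thesis
    by (rule is_pole_transform) (use ev in \<open>auto elim: eventually_mono\<close>)
qed

section \<open>Pseudomultipliers are modified rational functions\<close>

text \<open>
  A subspace of codimension \<open>m\<close> contains a nonzero polynomial \<open>p\<close> of degree at most \<open>m\<close>. The product \<open>\<psi> p\<close>
  extends to an entire function \<open>g\<close>. As \<open>\<psi>\<close> is bounded near infinity, \<open>g\<close> is dominated by \<open>p\<close> there
  and hence is a polynomial \<open>q\<close>. So \<open>\<psi>\<close> is the proper rational function \<open>q / p\<close> away from the roots
  of \<open>p\<close>, and the points missing from \<open>D\<close> are poles because they are singularities.
\<close>

lemma pseudomultiplier_imp_finite_modification:
  assumes "m_pseudomultiplier m fock_space N D \<psi>"
  shows "\<exists>D\<^sub>\<phi> \<phi>. proper_rational_function D\<^sub>\<phi> \<phi> \<and> finite_modification D \<psi> D\<^sub>\<phi> \<phi>"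
proof -
  from assms obtain E where fin: "finite (- D)" and sing: "\<And>z. z \<notin> D \<Longrightarrow> singularity fock_space D \<psi> z"
    and E: "closed_subspace fock_space N E" and codim: "has_codimension fock_space E m"
    and mult: "\<And>h. h \<in> E \<Longrightarrow> \<exists>g\<in>fock_space. \<forall>z\<in>D. g z = \<psi> z * h z"
    unfolding m_pseudomultiplier_def by blast
  have "(\<lambda>z. z ^ i) \<in> fock_space" for i
    using fock_poly[of "monom 1 i"] by (simp add: poly_monom[abs_def])
  then obtain c where c: "\<exists>i\<le>m. c i \<noteq> 0" and cE: "(\<lambda>z. \<Sum>i\<le>m. c i * z ^ i) \<in> E"
    using finite_codimension_combination[OF E codim, of "\<lambda>i z. z ^ i"] by metis
  define p where "p = (\<Sum>i\<le>m. monom (c i) i)"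
  have pE: "poly p \<in> E"
  proof -
    have "poly p = (\<lambda>z. \<Sum>i\<le>m. c i * z ^ i)"
      by (simp add: fun_eq_iff p_def poly_sum poly_monom)
    with cE show ?thesis by simp
  qed
  have "coeff p i = c i" if "i \<le> m" for i
    using that by (simp add: p_def coeff_sum)
  with c have p: "p \<noteq> 0" by force
  obtain g where g: "g \<in> fock_space" and gD: "\<And>z. z \<in> D \<Longrightarrow> g z = \<psi> z * poly p z"
    using mult[OF pE] by blast
  obtain R B where B: "\<And>z. z \<in> D \<Longrightarrow> R \<le> cmod z \<Longrightarrow> cmod (\<psi> z) \<le> B"
    using multiplier_bounded_near_infinity[OF E codim mult] by blast
  obtain S where S: "\<And>z. z \<notin> D \<Longrightarrow> cmod z \<le> S"
    using finite_imp_bounded[OF fin] by (auto simp: bounded_iff)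
  have le: "cmod (g z) \<le> B * cmod (poly p z)" if "max R (S + 1) \<le> cmod z" for z
  proof -
    have "z \<in> D" using S[of z] that by auto
    then show ?thesis using that B[of z] by (simp add: gD norm_mult mult_right_mono)
  qed
  obtain q where q: "g = poly q"
    using entire_dominated_by_poly[OF fock_spaceD(1)[OF g] le] by blast
  define F where "F = (\<lambda>w. poly q w / poly p w)"
  define D\<^sub>\<phi> where "D\<^sub>\<phi> = - {z. is_pole F z}"
  have F: "remove_sings F z = F z" "\<not> is_pole F z" if "poly p z \<noteq> 0" for z
    using remove_sings_rational[OF that] by (simp_all add: F_def)
  have fin_roots: "finite {z. poly p z = 0}" using p by (rule poly_roots_finite)
  have "rational_function D\<^sub>\<phi> (remove_sings F)"
    unfolding rational_function_def D\<^sub>\<phi>_def F_def using p by blast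
  moreover obtain l where "(F \<longlongrightarrow> l) at_infinity"
    unfolding F_def using bounded_quotient_tendsto_at_infinity[OF p le[unfolded q]] by blast
  then have "(remove_sings F \<longlongrightarrow> l) at_infinity"
    by (rule Lim_transform_eventually)
       (use poly_nonzero_near_infinity[OF p] in \<open>auto elim!: eventually_mono simp: F\<close>)
  ultimately have "proper_rational_function D\<^sub>\<phi> (remove_sings F)"
    unfolding proper_rational_function_def by blast
  moreover have "finite_modification D \<psi> D\<^sub>\<phi> (remove_sings F)"
    unfolding finite_modification_def
  proof (intro conjI)
    show "D\<^sub>\<phi> \<subseteq> D"
      using singularity_is_pole[OF p fin gD[unfolded q] sing] by (auto simp: D\<^sub>\<phi>_def F_def)
    show "finite (D - D\<^sub>\<phi>)"
      using F by (intro finite_subset[OF _ fin_roots]) (auto simp: D\<^sub>\<phi>_def)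
    have "remove_sings F z = \<psi> z" if "z \<in> D" "poly p z \<noteq> 0" for z
      using that gD[of z] by (simp add: F q) (simp add: F_def)
    then show "finite {z \<in> D\<^sub>\<phi>. remove_sings F z \<noteq> \<psi> z}"
      using \<open>D\<^sub>\<phi> \<subseteq> D\<close> by (intro finite_subset[OF _ fin_roots]) auto
  qed
  ultimately show ?thesis by blast
qed

section \<open>Rational functions in lowest terms\<close>

lemma common_factor_removal:
  fixes p q :: "complex poly"
  assumes "q \<noteq> 0"
  obtains d p' q' where "p = d * p'" "q = d * q'" "\<And>z. poly q' z = 0 \<Longrightarrow> poly p' z \<noteq> 0"
proof -
  from assms have "\<exists>d p' q'. p = d * p' \<and> q = d * q' \<and> (\<forall>z. poly q' z = 0 \<longrightarrow> poly p' z \<noteq> 0)"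
  proof (induction "degree q" arbitrary: p q rule: less_induct)
    case less
    show ?case
    proof (cases "\<exists>z. poly q z = 0 \<and> poly p z = 0")
      case True
      then obtain z p1 q1 where p1: "p = [:- z, 1:] * p1" and q1: "q = [:- z, 1:] * q1"
        by (auto simp: poly_eq_0_iff_dvd elim!: dvdE)
      then have "q1 \<noteq> 0" using less.prems by auto
      then have "degree q1 < degree q" unfolding q1 by (subst degree_mult_eq) auto
      from less.hyps[OF this \<open>q1 \<noteq> 0\<close>, of p1] obtain d p' q'
        where "p1 = d * p'" "q1 = d * q'" "\<forall>z. poly q' z = 0 \<longrightarrow> poly p' z \<noteq> 0" by blast
      then have "p = ([:- z, 1:] * d) * p'" "q = ([:- z, 1:] * d) * q'"
        unfolding p1 q1 by (simp_all only: mult.assoc)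
      then show ?thesis
        using \<open>\<forall>z. poly q' z = 0 \<longrightarrow> poly p' z \<noteq> 0\<close> by blast
    next
      case False
      then have "p = 1 * p" "q = 1 * q" "\<forall>z. poly q z = 0 \<longrightarrow> poly p z \<noteq> 0" by auto
      then show ?thesis by blast
    qed
  qed
  then show thesis using that by blast
qed

lemma rational_function_lowest_terms:
  assumes "rational_function D \<phi>"
  obtains p q where "q \<noteq> 0" "\<And>z. poly q z = 0 \<Longrightarrow> poly p z \<noteq> 0" "D = {z. poly q z \<noteq> 0}"
    "\<And>z. z \<in> D \<Longrightarrow> \<phi> z = poly p z / poly q z"
proof -
  obtain p0 q0 :: "complex poly" where q0: "q0 \<noteq> 0"
    and D: "D = - {z. is_pole (\<lambda>w. poly p0 w / poly q0 w) z}"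
    and \<phi>: "\<And>z. z \<in> D \<Longrightarrow> \<phi> z = remove_sings (\<lambda>w. poly p0 w / poly q0 w) z"
    using assms unfolding rational_function_def by blast
  obtain d p q where d: "p0 = d * p" "q0 = d * q" and pq: "\<And>z. poly q z = 0 \<Longrightarrow> poly p z \<noteq> 0"
    using common_factor_removal[OF q0] by metis
  have q: "q \<noteq> 0" and d0: "d \<noteq> 0" using q0 d by auto
  have ev: "eventually (\<lambda>w. poly p0 w / poly q0 w = poly p w / poly q w) (at z)" for z
    using eventually_cofinite_nhd[OF poly_roots_finite[OF d0], of z]
    by eventually_elim (simp add: d)
  have pole: "is_pole (\<lambda>w. poly p w / poly q w) z" if "poly q z = 0" for z
  proof (rule is_pole_divide)
    have "eventually (\<lambda>w. poly q w \<noteq> 0) (at z)"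
      using eventually_cofinite_nhd[OF poly_roots_finite[OF q], of z] by simp
    moreover have "poly q \<midarrow>z\<rightarrow> poly q z" using poly_isCont[of z q] by (simp add: isCont_def)
    ultimately show "filterlim (poly q) (at 0) (at z)" using that by (simp add: filterlim_at)
  qed (use pq[OF that] in auto)
  have D': "D = {z. poly q z \<noteq> 0}"
    using pole remove_sings_rational(2) by (auto simp: D is_pole_cong[OF ev refl])
  moreover have "\<phi> z = poly p z / poly q z" if "z \<in> D" for z
    using that \<phi>[OF that] remove_sings_cong[OF ev refl] remove_sings_rational(1) by (simp add: D')
  ultimately show thesis using that q pq by blast
qed

section \<open>Entire multiples of a polynomial\<close>

definition entire_multiple :: "complex poly \<Rightarrow> (complex \<Rightarrow> complex) \<Rightarrow> bool" where
  "entire_multiple p h \<longleftrightarrow> (\<exists>w. w holomorphic_on UNIV \<and> (\<forall>z. h z = poly p z * w z))"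

lemma entire_multiple_add:
  assumes "entire_multiple p f" "entire_multiple p g"
  shows "entire_multiple p (\<lambda>z. f z + g z)"
proof -
  obtain u v where "u holomorphic_on UNIV" "v holomorphic_on UNIV"
    "\<forall>z. f z = poly p z * u z" "\<forall>z. g z = poly p z * v z"
    using assms unfolding entire_multiple_def by blast
  then show ?thesis unfolding entire_multiple_def
    by (intro exI[of _ "\<lambda>z. u z + v z"]) (auto intro!: holomorphic_intros simp: algebra_simps)
qed

lemma entire_multiple_cmult:
  assumes "entire_multiple p f"
  shows "entire_multiple p (\<lambda>z. c * f z)"
proof -
  obtain u where "u holomorphic_on UNIV" "\<forall>z. f z = poly p z * u z"
    using assms unfolding entire_multiple_def by blast
  then show ?thesis unfolding entire_multiple_def
    by (intro exI[of _ "\<lambda>z. c * u z"]) (auto intro!: holomorphic_intros)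
qed

text \<open>
  Over the complex numbers a polynomial without roots is a constant; this is the base case of the
  inductions on roots below, which split off one linear factor at a time.
\<close>

lemma entire_multiple_root_free:
  assumes "\<And>a. poly p a \<noteq> 0" and "h holomorphic_on UNIV"
  shows "entire_multiple p h"
proof -
  have "(\<lambda>z. h z / poly p z) holomorphic_on UNIV"
    using assms fock_spaceD(1)[OF fock_poly] by (intro holomorphic_on_divide) auto
  then show ?thesis unfolding entire_multiple_def
    using assms(1) by (intro exI[of _ "\<lambda>z. h z / poly p z"]) auto
qed

lemma entire_multiple_linear_iff:
  assumes "h holomorphic_on UNIV"
  shows "entire_multiple [:a, -1:] h \<longleftrightarrow> h a = 0"
proof
  assume h: "h a = 0"
  have "(\<lambda>z. if z = a then deriv h a else h z / (z - a) - h a / (z - a)) holomorphic_on UNIV"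
    by (rule pole_theorem[OF assms]) auto
  then have "(\<lambda>z. - (if z = a then deriv h a else h z / (z - a) - h a / (z - a))) holomorphic_on UNIV"
    by (rule holomorphic_on_minus)
  then show "entire_multiple [:a, -1:] h" unfolding entire_multiple_def
    by (intro exI[of _ "\<lambda>z. - (if z = a then deriv h a else h z / (z - a) - h a / (z - a))"] conjI)
       (auto simp: h field_simps)
qed (auto simp: entire_multiple_def)

text \<open>
  Hermite interpolation: the remainder \<open>r\<close> has the same values as \<open>h\<close>, with multiplicities, at the roots
  of \<open>p\<close>. Splitting off a root \<open>a\<close> of \<open>[:a, -1:] * p\<close> replaces the quotient \<open>v\<close> by its
  difference quotient at \<open>a\<close> and adds \<open>v a\<close> times \<open>p\<close> to the remainder.
\<close>

lemma entire_division_by_poly: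
  assumes "p \<noteq> 0" "h holomorphic_on UNIV"
  shows "\<exists>r. (r = 0 \<or> degree r < degree p) \<and> entire_multiple p (\<lambda>z. h z - poly r z)"
  using assms
proof (induction p arbitrary: h rule: poly_root_induct[where P = "\<lambda>_. True"])
  case (no_roots p)
  then show ?case by (intro exI[of _ 0]) (auto intro: entire_multiple_root_free)
next
  case (root a p)
  then have p: "p \<noteq> 0" by auto
  obtain r v where r: "r = 0 \<or> degree r < degree p" and v: "v holomorphic_on UNIV"
    and hv: "\<And>z. h z - poly r z = poly p z * v z"
    using root.IH[OF p root.prems(2)] unfolding entire_multiple_def by blast
  obtain w where w: "w holomorphic_on UNIV" and vw: "\<And>z. v z - v a = (a - z) * w z"
  proof -
    have "(\<lambda>z. v z - v a) holomorphic_on UNIV"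
      by (intro holomorphic_intros v)
    then have "entire_multiple [:a, -1:] (\<lambda>z. v z - v a)"
      by (simp add: entire_multiple_linear_iff)
    then show thesis using that unfolding entire_multiple_def by auto
  qed
  let ?r = "r + smult (v a) p"
  have "h z - poly ?r z = poly ([:a, -1:] * p) z * w z" for z
  proof -
    have "h z - poly ?r z = poly p z * (v z - v a)" using hv[of z] by (simp add: algebra_simps)
    then show ?thesis by (simp add: vw algebra_simps)
  qed
  moreover have "degree ?r < degree ([:a, -1:] * p)"
  proof -
    have "degree ?r \<le> degree p" using r by (intro degree_add_le) auto
    then show ?thesis using p by (subst degree_mult_eq) auto
  qed
  ultimately show ?case using w unfolding entire_multiple_def by blast
qed auto

text \<open>
  The quotient \<open>r / p\<close> is entire and vanishes at infinity, so Liouville's theorem applies.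
\<close>

lemma entire_multiple_low_degree:
  assumes r: "degree r < degree p" and mult: "entire_multiple p (poly r)"
  shows "r = 0"
proof -
  obtain w where w: "w holomorphic_on UNIV" and rw: "\<And>z. poly r z = poly p z * w z"
    using mult unfolding entire_multiple_def by blast
  have p: "p \<noteq> 0" using r by auto
  have "((\<lambda>z. poly r z / poly p z) \<longlongrightarrow> 0) at_infinity"
    using r by (rule poly_divide_tendsto_0_at_infinity)
  moreover have "eventually (\<lambda>z. poly r z / poly p z = w z) at_infinity"
    using poly_nonzero_near_infinity[OF p] by eventually_elim (simp add: rw)
  ultimately have "(w \<longlongrightarrow> 0) at_infinity" by (rule Lim_transform_eventually)
  with w have "w z = 0" for z by (rule Liouville_weak_0)
  then have "poly r = poly 0" using rw by (simp add: fun_eq_iff)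
  then show ?thesis by (simp add: poly_eq_poly_eq_iff)
qed

text \<open>
  By the maximum principle it suffices to compare \<open>u n\<close> and \<open>v\<close> on a circle around \<open>a\<close> of radius \<open>\<rho>\<close>, where
  the factor \<open>a - z\<close> has modulus \<open>\<rho> \<ge> 1\<close>.
\<close>

lemma uniform_limit_divide_root:
  assumes u: "\<And>n. u n holomorphic_on UNIV" and v: "v holomorphic_on UNIV"
    and lim: "\<And>R. uniform_limit (cball 0 R) (\<lambda>n z. (a - z) * u n z) (\<lambda>z. (a - z) * v z) sequentially"
  shows "uniform_limit (cball 0 R) u v sequentially"
proof (rule uniform_limitI)
  fix e :: real assume "e > 0"
  define \<rho> where "\<rho> = cmod a + \<bar>R\<bar> + 1"
  have "eventually (\<lambda>n. \<forall>z\<in>cball (0::complex) (cmod a + \<rho>). dist ((a - z) * u n z) ((a - z) * v z) < e / 2) sequentially"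
    using lim \<open>e > 0\<close> by (intro uniform_limitD) auto
  then show "eventually (\<lambda>n. \<forall>z\<in>cball (0::complex) R. dist (u n z) (v z) < e) sequentially"
  proof eventually_elim
    case (elim n)
    show ?case
    proof
      fix z :: complex assume z: "z \<in> cball 0 R"
      have "cmod (u n z - v z) \<le> e / 2"
      proof (rule maximum_modulus_frontier[where f = "\<lambda>z. u n z - v z" and S = "cball a \<rho>"])
        have hol: "(\<lambda>z. u n z - v z) holomorphic_on S" for S
          by (rule holomorphic_on_subset[of _ UNIV]) (auto intro: holomorphic_intros u v)
        then show "(\<lambda>z. u n z - v z) holomorphic_on interior (cball a \<rho>)"
          and "continuous_on (closure (cball a \<rho>)) (\<lambda>z. u n z - v z)"
          by (auto intro: holomorphic_on_imp_continuous_on)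
        show "z \<in> cball a \<rho>"
          using z norm_triangle_ineq4[of a z] by (simp add: \<rho>_def dist_norm)
        fix y assume "y \<in> frontier (cball a \<rho>)"
        then have y: "cmod (a - y) = \<rho>" by (simp add: dist_norm)
        then have "cmod y \<le> cmod a + \<rho>"
          using norm_triangle_ineq2[of y a] by (simp add: norm_minus_commute)
        then have "cmod ((a - y) * (u n y - v y)) < e / 2"
          using elim by (simp add: dist_norm right_diff_distrib)
        then have "\<rho> * cmod (u n y - v y) < e / 2" by (simp add: norm_mult y)
        moreover have "1 * cmod (u n y - v y) \<le> \<rho> * cmod (u n y - v y)"
          by (rule mult_right_mono) (auto simp: \<rho>_def)
        ultimately show "cmod (u n y - v y) \<le> e / 2" by simp
      qed auto
      then show "dist (u n z) (v z) < e" using \<open>e > 0\<close> by (simp add: dist_norm)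
    qed
  qed
qed

lemma entire_multiple_limit:
  assumes "p \<noteq> 0" "\<And>n. entire_multiple p (f n)" "g holomorphic_on UNIV"
    and "\<And>R. uniform_limit (cball 0 R) f g sequentially"
  shows "entire_multiple p g"
  using assms
proof (induction p arbitrary: f g rule: poly_root_induct[where P = "\<lambda>_. True"])
  case (no_roots p)
  then show ?case by (auto intro: entire_multiple_root_free)
next
  case (root a p)
  have "\<exists>u. (\<forall>z. f n z = (a - z) * u z) \<and> entire_multiple p u \<and> u holomorphic_on UNIV" for n
  proof -
    obtain w where w: "w holomorphic_on UNIV" and "\<And>z. f n z = poly ([:a, -1:] * p) z * w z"
      using root.prems(2)[of n] unfolding entire_multiple_def by blast
    then show ?thesis
      unfolding entire_multiple_def
      by (intro exI[of _ "\<lambda>z. poly p z * w z"])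
         (auto intro!: holomorphic_on_mult fock_spaceD(1)[OF fock_poly] exI[of _ w] simp: algebra_simps)
  qed
  then obtain u where fu: "\<And>n z. f n z = (a - z) * u n z" and u: "\<And>n. entire_multiple p (u n)"
    "\<And>n. u n holomorphic_on UNIV" by metis
  have "(\<lambda>n. f n a) \<longlonglongrightarrow> g a"
    by (rule tendsto_uniform_limitI[OF root.prems(4)[of "cmod a"]]) simp
  then have "g a = 0" by (simp add: fu LIMSEQ_const_iff)
  then have "entire_multiple [:a, -1:] g"
    using entire_multiple_linear_iff[OF root.prems(3)] by simp
  then obtain v where v: "v holomorphic_on UNIV" and gv: "\<And>z. g z = (a - z) * v z"
    unfolding entire_multiple_def by auto
  have lim: "uniform_limit (cball 0 R) u v sequentially" for R
    using root.prems(4) by (intro uniform_limit_divide_root[OF u(2) v]) (simp add: fu gv flip: fun_eq_iff)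
  have "p \<noteq> 0" using root.prems(1) by auto
  from root.IH[OF this u(1) v lim] have "entire_multiple p v" .
  then obtain w where "w holomorphic_on UNIV" "\<And>z. v z = poly p z * w z"
    unfolding entire_multiple_def by blast
  then show ?case unfolding entire_multiple_def
    by (intro exI[of _ w]) (auto simp: gv algebra_simps)
qed auto

section \<open>The multiples of a polynomial in the Fock space\<close>

lemma fock_norm_convergence_uniform_on_discs:
  assumes f: "\<And>n. f n \<in> fock_space" and g: "g \<in> fock_space"
    and lim: "(\<lambda>n. fock_norm (\<lambda>z. f n z - g z)) \<longlonglongrightarrow> 0"
  shows "uniform_limit (cball 0 R) f g sequentially"
proof (rule uniform_limitI)
  fix e :: real assume e: "e > 0"
  obtain C where C: "C > 0"
    and le: "\<And>f z. f \<in> fock_space \<Longrightarrow> cmod (f z) \<le> C * exp ((cmod z)\<^sup>2 / 2) * fock_norm f"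
    using fock_pointwise_bound by metis
  define M where "M = C * exp (R\<^sup>2 / 2)"
  have "(\<lambda>n. M * fock_norm (\<lambda>z. f n z - g z)) \<longlonglongrightarrow> M * 0"
    by (intro tendsto_mult tendsto_const lim)
  then have "eventually (\<lambda>n. M * fock_norm (\<lambda>z. f n z - g z) < e) sequentially"
    using e by (intro order_tendstoD) auto
  then show "eventually (\<lambda>n. \<forall>z\<in>cball (0::complex) R. dist (f n z) (g z) < e) sequentially"
  proof eventually_elim
    case (elim n)
    show ?case
    proof
      fix z :: complex assume "z \<in> cball 0 R"
      then have "(cmod z)\<^sup>2 \<le> R\<^sup>2" by (intro power_mono) auto
      then have "C * exp ((cmod z)\<^sup>2 / 2) \<le> M" using C by (simp add: M_def)
      moreover have "0 \<le> fock_norm (\<lambda>z. f n z - g z)"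
        unfolding fock_norm_def by (intro real_sqrt_ge_zero mult_nonneg_nonneg Bochner_Integration.integral_nonneg) auto
      ultimately have "C * exp ((cmod z)\<^sup>2 / 2) * fock_norm (\<lambda>z. f n z - g z) \<le> M * fock_norm (\<lambda>z. f n z - g z)"
        by (rule mult_right_mono)
      with le[OF fock_diff[OF f g], of n z] elim show "dist (f n z) (g z) < e"
        by (simp add: dist_norm)
    qed
  qed
qed

lemma closed_subspace_multiples:
  assumes p: "p \<noteq> 0"
  shows "closed_subspace fock_space fock_norm {h \<in> fock_space. entire_multiple p h}"
  unfolding closed_subspace_def
proof (intro conjI allI ballI impI)
  show "(\<lambda>z. 0) \<in> {h \<in> fock_space. entire_multiple p h}"
    using fock_zero by (auto simp: entire_multiple_def intro!: exI[of _ "\<lambda>_. 0"])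
  fix f g assume f: "\<forall>n. f n \<in> {h \<in> fock_space. entire_multiple p h}" and g: "g \<in> fock_space"
    and lim: "(\<lambda>n. fock_norm (\<lambda>z. f n z - g z)) \<longlonglongrightarrow> 0"
  from f have "\<And>n. f n \<in> fock_space" "\<And>n. entire_multiple p (f n)" by auto
  from entire_multiple_limit[OF p this(2) fock_spaceD(1)[OF g]
      fock_norm_convergence_uniform_on_discs[OF this(1) g lim]]
  show "g \<in> {h \<in> fock_space. entire_multiple p h}" using g by simp
qed (auto intro: fock_add fock_cmult entire_multiple_add entire_multiple_cmult)

text \<open>
  The powers below the degree of \<open>p\<close> represent a basis of the quotient: they span it by division with
  remainder, and they are independent because no nonzero polynomial of smaller degree is a multiple of \<open>p\<close>.
\<close>

lemma has_codimension_multiples: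
  assumes p: "p \<noteq> 0"
  shows "has_codimension fock_space {h \<in> fock_space. entire_multiple p h} (degree p)"
  unfolding has_codimension_def
proof (intro exI[of _ "\<lambda>i z. z ^ i"] conjI allI ballI impI)
  show "(\<lambda>z. z ^ i) \<in> fock_space" for i
    using fock_poly[of "monom 1 i"] by (simp add: poly_monom[abs_def])
next
  fix h assume h: "h \<in> fock_space"
  obtain r where r: "r = 0 \<or> degree r < degree p" and mult: "entire_multiple p (\<lambda>z. h z - poly r z)"
    using entire_division_by_poly[OF p fock_spaceD(1)[OF h]] by blast
  have "poly r z = (\<Sum>i<degree p. coeff r i * z ^ i)" for z
    unfolding poly_altdef by (rule sum.mono_neutral_cong) (use r in \<open>auto simp: coeff_eq_0\<close>)
  with mult fock_diff[OF h fock_poly[of r]]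
  show "\<exists>c. (\<lambda>z. h z - (\<Sum>i<degree p. c i * z ^ i)) \<in> {h \<in> fock_space. entire_multiple p h}"
    by (intro exI[of _ "coeff r"]) simp
next
  fix c i assume c: "(\<lambda>z. \<Sum>i<degree p. c i * z ^ i) \<in> {h \<in> fock_space. entire_multiple p h}"
    and i: "i < degree p"
  define r where "r = (\<Sum>i<degree p. monom (c i) i)"
  have coeff: "coeff r j = (if j < degree p then c j else 0)" for j
    by (auto simp: r_def coeff_sum)
  have "poly r = (\<lambda>z. \<Sum>i<degree p. c i * z ^ i)"
    by (simp add: fun_eq_iff r_def poly_sum poly_monom)
  then have "entire_multiple p (poly r)" using c by simp
  moreover have "degree r < degree p"
    using i by (intro degree_lessI) (auto simp: coeff)
  ultimately have "r = 0" by (rule entire_multiple_low_degree[rotated])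
  then show "c i = 0" using coeff[of i] i by simp
qed

section \<open>Modified rational functions are pseudomultipliers\<close>

lemma cofinite_uniqueness_set:
  assumes "finite (- D)"
  shows "uniqueness_set fock_space D"
  unfolding uniqueness_set_def
proof (intro ballI impI ext)
  fix f g z assume f: "f \<in> fock_space" and g: "g \<in> fock_space" and eq: "\<forall>z\<in>D. f z = g z"
  have "eventually (\<lambda>w. w \<notin> - D) (at z)" using assms by (rule eventually_cofinite_nhd)
  then have ev: "eventually (\<lambda>w. f w = g w) (at z)" by eventually_elim (use eq in auto)
  have cont: "h \<midarrow>z\<rightarrow> h z" if "h \<in> fock_space" for h
    using holomorphic_on_imp_continuous_on[OF fock_spaceD(1)[OF that]]
    by (simp add: continuous_on_eq_continuous_at isCont_def)
  have "f \<midarrow>z\<rightarrow> g z" using cont[OF g] ev by (simp add: tendsto_cong)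
  with cont[OF f] show "f z = g z" by (rule LIM_unique)
qed

text \<open>
  Let \<open>\<phi> = p / q\<close> in lowest terms, let \<open>F\<close> be the finite set of points of \<open>D\<close> at which \<open>\<phi>\<close> is undefined or
  differs from \<open>\<psi>\<close>, and let \<open>s\<close> vanish exactly on \<open>F\<close>. Multiplying \<open>q * s * w\<close> by \<open>\<psi>\<close> gives
  \<open>p * s * w\<close> on all of \<open>D\<close>: on \<open>F\<close> both products are 0, whatever value \<open>\<psi>\<close> has there. Thus the multiples
  of \<open>q * s\<close> form the required subspace; their images stay in the Fock space because \<open>\<phi>\<close> is bounded
  near infinity. At a point outside \<open>D\<close> the polynomials \<open>q * s\<close> and \<open>p * s\<close> exhibit the singularity,
  since such a point is a root of \<open>q\<close> but neither of \<open>p\<close> nor of \<open>s\<close>.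
\<close>

lemma finite_modification_imp_pseudomultiplier:
  assumes proper: "proper_rational_function D\<^sub>\<phi> \<phi>" and modif: "finite_modification D \<psi> D\<^sub>\<phi> \<phi>"
  shows "\<exists>m. m_pseudomultiplier m fock_space fock_norm D \<psi>"
proof -
  obtain l where rat: "rational_function D\<^sub>\<phi> \<phi>" and l: "(\<phi> \<longlongrightarrow> l) at_infinity"
    using proper unfolding proper_rational_function_def by blast
  obtain p q where q: "q \<noteq> 0" and pq: "\<And>z. poly q z = 0 \<Longrightarrow> poly p z \<noteq> 0"
    and D\<^sub>\<phi>: "D\<^sub>\<phi> = {z. poly q z \<noteq> 0}" and \<phi>: "\<And>z. z \<in> D\<^sub>\<phi> \<Longrightarrow> \<phi> z = poly p z / poly q z"
    using rational_function_lowest_terms[OF rat] by metis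
  have "eventually (\<lambda>z. cmod (\<phi> z) < cmod l + 1) at_infinity"
    using tendsto_norm[OF l] by (rule order_tendstoD) simp
  then have "eventually (\<lambda>z. cmod (poly p z) \<le> (cmod l + 1) * cmod (poly q z)) at_infinity"
    using poly_nonzero_near_infinity[OF q]
    by eventually_elim (simp add: \<phi> D\<^sub>\<phi> norm_divide field_simps)
  then obtain R where R: "\<And>z. R \<le> cmod z \<Longrightarrow> cmod (poly p z) \<le> (cmod l + 1) * cmod (poly q z)"
    unfolding eventually_at_infinity by blast
  define F where "F = (D - D\<^sub>\<phi>) \<union> {z \<in> D\<^sub>\<phi>. \<phi> z \<noteq> \<psi> z}"
  have F: "finite F" and sub: "D\<^sub>\<phi> \<subseteq> D" and FD: "F \<subseteq> D"
    using modif by (auto simp: F_def finite_modification_def)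
  define s where "s = (\<Prod>b\<in>F. [:- b, 1:])"
  have s: "poly s z = 0 \<longleftrightarrow> z \<in> F" for z
    using F by (auto simp: s_def poly_prod)
  have s0: "s \<noteq> 0" using F by (auto simp: s_def)
  have \<psi>: "poly p z * poly s z = \<psi> z * (poly q z * poly s z)" if "z \<in> D" for z
  proof (cases "z \<in> F")
    case False
    with that have "z \<in> D\<^sub>\<phi>" "\<phi> z = \<psi> z" by (auto simp: F_def)
    then have "poly p z = \<psi> z * poly q z" using \<phi>[of z] by (simp add: D\<^sub>\<phi> field_simps)
    then show ?thesis by (simp add: mult.assoc)
  qed (simp add: s)
  have roots: "- D \<subseteq> {z. poly q z = 0}" using sub D\<^sub>\<phi> by auto
  then have fin: "finite (- D)" using poly_roots_finite[OF q] by (rule finite_subset)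
  define E where "E = {h \<in> fock_space. entire_multiple (q * s) h}"
  have "m_pseudomultiplier (degree (q * s)) fock_space fock_norm D \<psi>"
    unfolding m_pseudomultiplier_def
  proof (intro conjI ballI exI[of _ E])
    show "uniqueness_set fock_space D" using fin by (rule cofinite_uniqueness_set)
    show "finite (- D)" by (rule fin)
    have "card (- D) \<le> card {z. poly q z = 0}"
      using poly_roots_finite[OF q] roots by (rule card_mono)
    also have "\<dots> \<le> degree q" by (rule card_poly_roots_bound[OF q])
    also have "\<dots> \<le> degree (q * s)" using q s0 by (simp add: degree_mult_eq)
    finally show "card (- D) \<le> degree (q * s)" .
    show "closed_subspace fock_space fock_norm E" "has_codimension fock_space E (degree (q * s))"
      unfolding E_def using q s0 by (auto intro!: closed_subspace_multiples has_codimension_multiples)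
  next
    fix z assume z: "z \<in> - D"
    then have "poly q z = 0" "z \<notin> F" using roots FD by auto
    then show "singularity fock_space D \<psi> z"
      unfolding singularity_def
      by (intro bexI[of _ "poly (q * s)"] bexI[of _ "poly (p * s)"] conjI)
         (auto simp: fock_poly \<psi> s pq)
  next
    fix h assume "h \<in> E"
    then obtain w where h: "h \<in> fock_space" and w: "w holomorphic_on UNIV"
      and hw: "\<And>z. h z = poly (q * s) z * w z"
      unfolding E_def entire_multiple_def by blast
    define g where "g z = poly (p * s) z * w z" for z
    have "g \<in> fock_space"
    proof (rule fock_dominated[OF h])
      show "g holomorphic_on UNIV"
        unfolding g_def by (intro holomorphic_on_mult w fock_spaceD(1)[OF fock_poly])
      fix z assume "R \<le> cmod z"
      then have "cmod (poly p z) * (cmod (poly s z) * cmod (w z))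
          \<le> (cmod l + 1) * cmod (poly q z) * (cmod (poly s z) * cmod (w z))"
        by (intro mult_right_mono R) auto
      then show "cmod (g z) \<le> (cmod l + 1) * cmod (h z)"
        by (simp add: g_def hw norm_mult mult_ac)
    qed
    moreover have "g z = \<psi> z * h z" if "z \<in> D" for z
      using \<psi>[OF that] by (auto simp: g_def hw)
    ultimately show "\<exists>g\<in>fock_space. \<forall>z\<in>D. g z = \<psi> z * h z" by blast
  qed
  then show ?thesis by blast
qed

theorem theorem3p5:
  fixes D\<^sub>\<psi> :: "complex set" and \<psi> :: "complex \<Rightarrow> complex"
  shows "pseudomultiplier fock_space fock_norm D\<^sub>\<psi> \<psi> \<longleftrightarrow>
    (\<exists>D\<^sub>\<phi> \<phi>. proper_rational_function D\<^sub>\<phi> \<phi> \<and> finite_modification D\<^sub>\<psi> \<psi> D\<^sub>\<phi> \<phi>)"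
  unfolding pseudomultiplier_def
  using pseudomultiplier_imp_finite_modification finite_modification_imp_pseudomultiplier
  by blast

end
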